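(* Let $A$ be a nonzero commutative ring and let $f_1,\dots,f_n\in A[x_1,\dots,x_n]$ be such that $\det(J(\boldsymbol f,\boldsymbol x))\in A[x_1,\dots,x_n]^\times$, where $J(\boldsymbol f,\boldsymbol x)=(\partial f_i/\partial x_j)_{i,j}$. Then the iterative higher derivation $\theta_{\boldsymbol f}:A[f_1,\dots,f_n]\to A[f_1,\dots,f_n][[T_1,\dots,T_n]]$ uniquely extends to an ($n$-variate) higher derivation on $A[x_1,\dots,x_n]$, also called $\theta_{\boldsymbol f}$. This extension has the following properties: (i) If $A$ has characteristic $p^e$ ($p$ prime), then for all $L\ge 0$, all $i=1,\dots,n$, and all $N\in\mathbb N$ such that $p^{N-e+1}>L$, one has for all polynomials $a_{\boldsymbol\alpha}$ in $n$ variables over $A$ $$\theta^{(L)}_{f_i}\Bigl(\sum_{\boldsymbol\alpha}a_{\boldsymbol\alpha}(x_1^{p^N},\dots,x_n^{p^N})\,\boldsymbol f^{\boldsymbol\alpha}\Bigr)=\sum_{\boldsymbol\alpha}a_{\boldsymbol\alpha}(x_1^{p^N},\dots,x_n^{p^N})\binom{\alpha_i}{L}\boldsymbol f^{\boldsymbol\alpha-L\boldsymbol e_i},$$ where both sums run over all $\boldsymbol\alpha\in\mathbb N^n$ with $0\le\alpha_k\le p^N-1$ for all $k$. In particular, this holds for $N=e+\operatorname{ord}_p(L!)$. (ii) $\theta_{\boldsymbol f}$ is an iterative higher derivation on $A[x_1,\dots,x_n]$; in particular, for all $L>0$ and all $i$, $L!\cdot\theta^{(L)}_{f_i}=\bigl(\tfrac{\partial}{\partial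 f_i}\bigr)^L$. (iii) If $\phi:A\to A'$ is a homomorphism of nonzero commutative rings, and $\Phi:A[x_1,\dots,x_n]\to A'[x_1,\dots,x_n]$ and $\Phi[[\boldsymbol T]]:A[x_1,\dots,x_n][[\boldsymbol T]]\to A'[x_1,\dots,x_n][[\boldsymbol T]]$ are the homomorphisms induced by $\phi$ (applying $\phi$ to coefficients), then $\Phi[[\boldsymbol T]]\circ\theta_{\boldsymbol f}=\theta_{\phi(\boldsymbol f)}\circ\Phi$, where $\phi(\boldsymbol f)=(\Phi(f_1),\dots,\Phi(f_n))$.
   Context: $\mathbb N$ contains $0$; multi-index notation is used, with $\boldsymbol f^{\boldsymbol\alpha}=f_1^{\alpha_1}\cdots f_n^{\alpha_n}$, and $\boldsymbol e_i$ denotes the $i$-th unit vector. An $n$-variate higher derivation on a commutative ring $R$ is a ring homomorphism $\theta:R\to R[[T_1,\dots,T_n]]$ with $\theta(r)|_{\boldsymbol T=\boldsymbol 0}=r$ for all $r\in R$; $\theta^{(\boldsymbol\alpha)}(r)$ denotes the coefficient of $\boldsymbol T^{\boldsymbol\alpha}$ in $\theta(r)$. It is iterative if $\theta^{(\boldsymbol\alpha)}\circ\theta^{(\boldsymbol\beta)}=\binom{\boldsymbol\alpha+\boldsymbol\beta}{\boldsymbol\alpha}\theta^{(\boldsymbol\alpha+\boldsymbol\beta)}$ for all $\boldsymbol\alpha,\boldsymbol\beta\in\mathbb N^n$, where $\binom{\boldsymbol\alpha}{\boldsymbol\beta}=\prod_i\binom{\alpha_i}{\beta_i}$. The higher derivation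 $\theta_{\boldsymbol f}$ on the $A$-subalgebra $A[f_1,\dots,f_n]\subseteq A[x_1,\dots,x_n]$ (a polynomial ring in $f_1,\dots,f_n$) is the $A$-algebra homomorphism with $\theta_{\boldsymbol f}(f_i)=f_i+T_i$; it is iterative. For its extension to $A[x_1,\dots,x_n]$, write $\theta^{(L)}_{f_i}:=\theta_{\boldsymbol f}^{(L\boldsymbol e_i)}$ for $L\in\mathbb N$ and $\frac{\partial}{\partial f_i}:=\theta^{(1)}_{f_i}$. Terms in (i) with $L>\alpha_i$ are zero since $\binom{\alpha_i}{L}=0$. $\operatorname{ord}_p$ denotes the $p$-adic valuation. In (iii), $\theta_{\phi(\boldsymbol f)}$ denotes the corresponding extended higher derivation on $A'[x_1,\dots,x_n]$ for the tuple $\phi(\boldsymbol f)$, whose Jacobian determinant is again a unit. *)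

theory Defs
  imports "HOL-Analysis.Analysis" "HOL-Library.Poly_Mapping" "HOL-Library.FuncSet"
    "HOL-Computational_Algebra.Computational_Algebra"
begin

section \<open>Multi-indices and polynomials in finitely many variables\<close>

text \<open>
  The variables are indexed by a finite type \<open>'n\<close>, so \<open>n\<close> is \<open>CARD('n)\<close>.
  The product on \<open>mvpoly\<close> is the convolution product of
  \<^theory>\<open>HOL-Library.Poly_Mapping\<close>, so \<open>mvpoly\<close> is the ring
  \<open>A[x\<^sub>1, \<dots>, x\<^sub>n]\<close>.
\<close>

type_synonym 'n mindex = "'n \<Rightarrow>\<^sub>0 nat"

type_synonym ('n, 'a) mvpoly = "('n \<Rightarrow>\<^sub>0 nat) \<Rightarrow>\<^sub>0 'a"

definition mbinom :: "'n::finite mindex \<Rightarrow> 'n mindex \<Rightarrow> nat" where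
  "mbinom \<alpha> \<beta> = (\<Prod>i\<in>UNIV. Poly_Mapping.lookup \<alpha> i choose Poly_Mapping.lookup \<beta> i)"

definition mpow :: "('n::finite \<Rightarrow> 'r::comm_ring_1) \<Rightarrow> 'n mindex \<Rightarrow> 'r" where
  "mpow f \<alpha> = (\<Prod>i\<in>UNIV. f i ^ Poly_Mapping.lookup \<alpha> i)"

definition pconst :: "'a::comm_ring_1 \<Rightarrow> ('n::finite, 'a) mvpoly" where
  "pconst c = Poly_Mapping.single 0 c"

definition pvar :: "'n::finite \<Rightarrow> ('n, 'a::comm_ring_1) mvpoly" where
  "pvar i = Poly_Mapping.single (Poly_Mapping.single i 1) 1"

text \<open>
  For \<open>Poly_Mapping.lookup \<alpha> j = 0\<close> the subtraction of multi-indices is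
  truncated, but then the coefficient of the monomial is zero.
\<close>

definition pdiff :: "'n::finite \<Rightarrow> ('n, 'a::comm_ring_1) mvpoly \<Rightarrow> ('n, 'a) mvpoly" where
  "pdiff j p = (\<Sum>\<alpha>\<in>Poly_Mapping.keys p.
     Poly_Mapping.single (\<alpha> - Poly_Mapping.single j 1)
       (of_nat (Poly_Mapping.lookup \<alpha> j) * Poly_Mapping.lookup p \<alpha>))"

definition poly_jacobian :: "('n::finite \<Rightarrow> ('n, 'a::comm_ring_1) mvpoly) \<Rightarrow> ('n, 'a) mvpoly ^ 'n ^ 'n" where
  "poly_jacobian f = (\<chi> i j. pdiff j (f i))"

definition psubst ::
    "('n::finite \<Rightarrow> ('n, 'a::comm_ring_1) mvpoly) \<Rightarrow> ('n, 'a) mvpoly \<Rightarrow> ('n, 'a) mvpoly" where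
  "psubst g p = (\<Sum>\<alpha>\<in>Poly_Mapping.keys p. pconst (Poly_Mapping.lookup p \<alpha>) * mpow g \<alpha>)"

text \<open>The subalgebra \<open>A[f\<^sub>1, \<dots>, f\<^sub>n]\<close> of \<open>A[x\<^sub>1, \<dots>, x\<^sub>n]\<close>.\<close>

definition subalg :: "('n::finite \<Rightarrow> ('n, 'a::comm_ring_1) mvpoly) \<Rightarrow> ('n, 'a) mvpoly set" where
  "subalg f = range (psubst f)"


section \<open>Formal power series in finitely many variables\<close>

typedef (overloaded) ('n, 'r) mfps = "UNIV :: (('n \<Rightarrow>\<^sub>0 nat) \<Rightarrow> 'r) set"
  morphisms mfps_nth Abs_mfps
  by simp

lemma mfps_eq_iff: "a = b \<longleftrightarrow> (\<forall>\<alpha>. mfps_nth a \<alpha> = mfps_nth b \<alpha>)"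
  by (metis ext mfps_nth_inject)

lemma mfps_nth_Abs [simp]: "mfps_nth (Abs_mfps h) = h"
  by (simp add: Abs_mfps_inverse)

lemma finite_mindex_bounded: "finite {\<alpha>::'n::finite mindex. \<forall>i. Poly_Mapping.lookup \<alpha> i \<le> B i}"
proof (rule finite_imageD)
  have "Poly_Mapping.lookup ` {\<alpha>::'n mindex. \<forall>i. Poly_Mapping.lookup \<alpha> i \<le> B i}
      \<subseteq> (\<Pi>\<^sub>E i\<in>UNIV. {..B i})"
    by auto
  then show "finite (Poly_Mapping.lookup ` {\<alpha>::'n mindex. \<forall>i. Poly_Mapping.lookup \<alpha> i \<le> B i})"
    by (rule finite_subset) (intro finite_PiE, auto)
  show "inj_on Poly_Mapping.lookup {\<alpha>::'n mindex. \<forall>i. Poly_Mapping.lookup \<alpha> i \<le> B i}"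
    by (auto intro: inj_onI)
qed

lemma finite_mindex_split [simp]: "finite {(\<beta>, \<gamma>). \<beta> + \<gamma> = (\<alpha>::'n::finite mindex)}"
proof (rule finite_subset)
  let ?B = "{\<beta>::'n mindex. \<forall>i. Poly_Mapping.lookup \<beta> i \<le> Poly_Mapping.lookup \<alpha> i}"
  show "{(\<beta>, \<gamma>). \<beta> + \<gamma> = \<alpha>} \<subseteq> ?B \<times> ?B"
    by (auto simp: lookup_add)
  show "finite (?B \<times> ?B)"
    by (intro finite_cartesian_product finite_mindex_bounded)
qed

lemmas finite_mindex_split' [simp] = finite_mindex_split[unfolded split_def]

instantiation mfps :: (finite, comm_ring_1) comm_ring_1
begin

definition "(0 :: ('a, 'b) mfps) = Abs_mfps (\<lambda>_. 0)"

definition "(1 :: ('a, 'b) mfps) = Abs_mfps (\<lambda>\<alpha>. if \<alpha> = 0 then 1 else 0)"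

definition "(a :: ('a, 'b) mfps) + b = Abs_mfps (\<lambda>\<alpha>. mfps_nth a \<alpha> + mfps_nth b \<alpha>)"

definition "- (a :: ('a, 'b) mfps) = Abs_mfps (\<lambda>\<alpha>. - mfps_nth a \<alpha>)"

definition "(a :: ('a, 'b) mfps) - b = Abs_mfps (\<lambda>\<alpha>. mfps_nth a \<alpha> - mfps_nth b \<alpha>)"

definition "(a :: ('a, 'b) mfps) * b =
  Abs_mfps (\<lambda>\<alpha>. \<Sum>(\<beta>, \<gamma>)\<in>{(\<beta>, \<gamma>). \<beta> + \<gamma> = \<alpha>}. mfps_nth a \<beta> * mfps_nth b \<gamma>)"

instance
proof
  fix a b c :: "('a, 'b) mfps"
  show "a + b + c = a + (b + c)" "a + b = b + a" "0 + a = a" "- a + a = 0" "a - b = a + - b"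
    by (simp_all add: plus_mfps_def zero_mfps_def uminus_mfps_def minus_mfps_def
        mfps_eq_iff algebra_simps)
  show "(0 :: ('a, 'b) mfps) \<noteq> 1"
    by (auto simp: zero_mfps_def one_mfps_def mfps_eq_iff)
  show "(a + b) * c = a * c + b * c"
    by (simp add: plus_mfps_def times_mfps_def mfps_eq_iff algebra_simps sum.distrib split_def)
  show "a * b = b * a"
    unfolding times_mfps_def mfps_eq_iff
    by (auto intro!: sum.reindex_bij_witness[where i = "\<lambda>(x, y). (y, x)" and j = "\<lambda>(x, y). (y, x)"]
        simp: ac_simps)
  show "1 * a = a"
  proof -
    have "(\<Sum>(\<beta>, \<gamma>)\<in>{(\<beta>, \<gamma>). \<beta> + \<gamma> = \<alpha>}. mfps_nth (1 :: ('a, 'b) mfps) \<beta> * mfps_nth a \<gamma>)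
        = (\<Sum>(\<beta>, \<gamma>)\<in>{(0, \<alpha>)}. mfps_nth 1 \<beta> * mfps_nth a \<gamma>)" for \<alpha>
      by (intro sum.mono_neutral_right) (auto simp: one_mfps_def split: if_splits)
    then show ?thesis
      by (simp add: times_mfps_def mfps_eq_iff) (simp add: one_mfps_def)
  qed
  show "a * b * c = a * (b * c)"
  proof -
    let ?P = "\<lambda>\<alpha>::'a mindex. {(\<beta>, \<gamma>). \<beta> + \<gamma> = \<alpha>}"
    have "(\<Sum>(\<mu>, \<delta>)\<in>?P \<alpha>. (\<Sum>(\<beta>, \<gamma>)\<in>?P \<mu>. mfps_nth a \<beta> * mfps_nth b \<gamma>) * mfps_nth c \<delta>)
        = (\<Sum>(\<beta>, \<mu>)\<in>?P \<alpha>. mfps_nth a \<beta> * (\<Sum>(\<gamma>, \<delta>)\<in>?P \<mu>. mfps_nth b \<gamma> * mfps_nth c \<delta>))"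
      (is "?L = ?R") for \<alpha>
    proof -
      have "?L = (\<Sum>((\<mu>, \<delta>), (\<beta>, \<gamma>))\<in>Sigma (?P \<alpha>) (\<lambda>(\<mu>, \<delta>). ?P \<mu>).
          mfps_nth a \<beta> * mfps_nth b \<gamma> * mfps_nth c \<delta>)"
        by (subst sum.Sigma[symmetric]) (auto simp: sum_distrib_right split_def)
      also have "\<dots> = (\<Sum>((\<beta>, \<mu>), (\<gamma>, \<delta>))\<in>Sigma (?P \<alpha>) (\<lambda>(\<beta>, \<mu>). ?P \<mu>).
          mfps_nth a \<beta> * (mfps_nth b \<gamma> * mfps_nth c \<delta>))"
        by (rule sum.reindex_bij_witness[where
              i = "\<lambda>((\<beta>, \<mu>), (\<gamma>, \<delta>)). ((\<beta> + \<gamma>, \<delta>), (\<beta>, \<gamma>))" and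
              j = "\<lambda>((\<mu>, \<delta>), (\<beta>, \<gamma>)). ((\<beta>, \<gamma> + \<delta>), (\<gamma>, \<delta>))"])
          (auto simp: ac_simps)
      also have "\<dots> = ?R"
        by (subst sum.Sigma[symmetric]) (auto simp: sum_distrib_left split_def)
      finally show ?thesis .
    qed
    then show ?thesis
      by (simp add: times_mfps_def mfps_eq_iff)
  qed
qed

end

definition mfps_const :: "'r::comm_ring_1 \<Rightarrow> ('n::finite, 'r) mfps" where
  "mfps_const c = Abs_mfps (\<lambda>\<alpha>. if \<alpha> = 0 then c else 0)"

definition mfps_var :: "'n::finite \<Rightarrow> ('n, 'r::comm_ring_1) mfps" where
  "mfps_var i = Abs_mfps (\<lambda>\<alpha>. if \<alpha> = Poly_Mapping.single i 1 then 1 else 0)"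

definition mfps_map :: "('r \<Rightarrow> 's) \<Rightarrow> ('n, 'r) mfps \<Rightarrow> ('n, 's) mfps" where
  "mfps_map h F = Abs_mfps (\<lambda>\<alpha>. h (mfps_nth F \<alpha>))"

text \<open>The subring \<open>S[[T]]\<close> of \<open>R[[T]]\<close> for a subring \<open>S\<close> of \<open>R\<close>.\<close>

definition mfps_over :: "'r set \<Rightarrow> ('n, 'r) mfps set" where
  "mfps_over S = {F. \<forall>\<alpha>. mfps_nth F \<alpha> \<in> S}"


section \<open>Higher derivations\<close>

text \<open>
  Rings are given as subrings \<open>S\<close> of an ambient ring type, \<open>S = UNIV\<close> being the
  ambient ring itself.  Values outside of \<open>S\<close> are irrelevant.
\<close>

definition ring_hom_on :: "'r::comm_ring_1 set \<Rightarrow> ('r \<Rightarrow> 's::comm_ring_1) \<Rightarrow> bool" where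
  "ring_hom_on S h \<longleftrightarrow> h 1 = 1 \<and>
     (\<forall>a\<in>S. \<forall>b\<in>S. h (a + b) = h a + h b \<and> h (a * b) = h a * h b)"

definition higher_derivation_on ::
    "'r::comm_ring_1 set \<Rightarrow> ('r \<Rightarrow> ('n::finite, 'r) mfps) \<Rightarrow> bool" where
  "higher_derivation_on S \<theta> \<longleftrightarrow> ring_hom_on S \<theta> \<and> \<theta> ` S \<subseteq> mfps_over S \<and>
     (\<forall>r\<in>S. mfps_nth (\<theta> r) 0 = r)"

text \<open>The map \<open>\<theta>\<^sup>(\<^sup>\<alpha>\<^sup>)\<close>.\<close>

definition hd_coeff :: "('r \<Rightarrow> ('n, 'r) mfps) \<Rightarrow> 'n mindex \<Rightarrow> 'r \<Rightarrow> 'r" where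
  "hd_coeff \<theta> \<alpha> r = mfps_nth (\<theta> r) \<alpha>"

definition iterative_on ::
    "'r::comm_ring_1 set \<Rightarrow> ('r \<Rightarrow> ('n::finite, 'r) mfps) \<Rightarrow> bool" where
  "iterative_on S \<theta> \<longleftrightarrow> (\<forall>r\<in>S. \<forall>\<alpha> \<beta>.
     hd_coeff \<theta> \<alpha> (hd_coeff \<theta> \<beta> r) = of_nat (mbinom (\<alpha> + \<beta>) \<alpha>) * hd_coeff \<theta> (\<alpha> + \<beta>) r)"

text \<open>
  \<open>\<theta>\<close> is an \<open>A\<close>-algebra homomorphism from \<open>A[f]\<close> to \<open>A[f][[T]]\<close> with
  \<open>f\<^sub>i \<mapsto> f\<^sub>i + T\<^sub>i\<close>.  Extensionality fixes the irrelevant values outside of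
  \<open>A[f]\<close>, so that uniqueness can be expressed by \<open>\<exists>!\<close>.
\<close>

definition is_theta_subalg ::
    "('n::finite \<Rightarrow> ('n, 'a::comm_ring_1) mvpoly) \<Rightarrow>
     (('n, 'a) mvpoly \<Rightarrow> ('n, ('n, 'a) mvpoly) mfps) \<Rightarrow> bool" where
  "is_theta_subalg f \<theta> \<longleftrightarrow>
     \<theta> \<in> subalg f \<rightarrow>\<^sub>E mfps_over (subalg f) \<and>
     ring_hom_on (subalg f) \<theta> \<and>
     (\<forall>c. \<theta> (pconst c) = mfps_const (pconst c)) \<and>
     (\<forall>i. \<theta> (f i) = mfps_const (f i) + mfps_var i)"

definition theta_subalg ::
    "('n::finite \<Rightarrow> ('n, 'a::comm_ring_1) mvpoly) \<Rightarrow> ('n, 'a) mvpoly \<Rightarrow> ('n, ('n, 'a) mvpoly) mfps" where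
  "theta_subalg f = (THE \<theta>. is_theta_subalg f \<theta>)"

definition is_theta_extension ::
    "('n::finite \<Rightarrow> ('n, 'a::comm_ring_1) mvpoly) \<Rightarrow>
     (('n, 'a) mvpoly \<Rightarrow> ('n, ('n, 'a) mvpoly) mfps) \<Rightarrow> bool" where
  "is_theta_extension f \<theta> \<longleftrightarrow>
     higher_derivation_on UNIV \<theta> \<and> (\<forall>g\<in>subalg f. \<theta> g = theta_subalg f g)"

definition theta ::
    "('n::finite \<Rightarrow> ('n, 'a::comm_ring_1) mvpoly) \<Rightarrow> ('n, 'a) mvpoly \<Rightarrow> ('n, ('n, 'a) mvpoly) mfps" where
  "theta f = (THE \<theta>. is_theta_extension f \<theta>)"

text \<open>
  The coefficient map of \<open>theta f\<close> at the multi-index \<open>L e\<^sub>i\<close>; for \<open>L = 1\<close> this is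
  \<open>\<partial>/\<partial>f\<^sub>i\<close>.
\<close>

definition theta_dir ::
    "('n::finite \<Rightarrow> ('n, 'a::comm_ring_1) mvpoly) \<Rightarrow> 'n \<Rightarrow> nat \<Rightarrow> ('n, 'a) mvpoly \<Rightarrow> ('n, 'a) mvpoly" where
  "theta_dir f i L = hd_coeff (theta f) (Poly_Mapping.single i L)"

text \<open>
  The sum of \<open>a\<^sub>\<alpha>(x\<^sub>1\<^sup>q, \<dots>, x\<^sub>n\<^sup>q) b\<^sub>\<alpha>\<close> over all \<open>\<alpha>\<close> with
  \<open>0 \<le> \<alpha>\<^sub>k \<le> q - 1\<close> for all \<open>k\<close>.
\<close>

definition box_sum ::
    "nat \<Rightarrow> ('n::finite mindex \<Rightarrow> ('n, 'a::comm_ring_1) mvpoly) \<Rightarrow>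
     ('n mindex \<Rightarrow> ('n, 'a) mvpoly) \<Rightarrow> ('n, 'a) mvpoly" where
  "box_sum q a b = (\<Sum>\<alpha>\<in>{\<alpha>. \<forall>k. Poly_Mapping.lookup \<alpha> k \<le> q - 1}.
     psubst (\<lambda>k. pvar k ^ q) (a \<alpha>) * b \<alpha>)"

end

theory Submission
  imports Defs
begin

text \<open>
  Two homomorphisms from \<open>A[x]\<close> to a power series ring that agree on \<open>A\<close>, on the \<open>f\<^sub>i\<close> and modulo
  \<open>T\<close> are equal: at the lowest degree where they could differ, their difference is an
  \<open>A\<close>-derivation killing the \<open>f\<^sub>i\<close>, and the Jacobian matrix is invertible.  This gives uniqueness
  of the extension, base change (iii), and iterativity, where \<open>\<theta>\<close> applied to the coefficients of
  \<open>\<theta>(r)\<close> is compared with \<open>\<theta>(r)\<close> at \<open>T + U\<close>.  Existence is Newton's method for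
  \<open>f(\<xi>) = f(x) + T\<close> with constant term \<open>\<xi>(0) = x\<close>; restricting to the subalgebra, no algebraic
  independence of the \<open>f\<^sub>i\<close> has to be known in advance.  For (i), set all variables but
  \<open>T\<^sub>i\<close> to zero: modulo \<open>T\<^sub>i\<^bsup>L+1\<^esup>\<close> the binomial coefficients of \<open>p\<^sup>N\<close> make \<open>\<theta>\<close> fix each
  \<open>x\<^sub>k\<close> to the power \<open>p\<^sup>N\<close>.
\<close>

section \<open>Ring homomorphisms\<close>

locale ring_hom_UNIV =
  fixes h :: "'r::comm_ring_1 \<Rightarrow> 's::comm_ring_1"
  assumes ring_hom: "ring_hom_on UNIV h"
begin

lemma one: "h 1 = 1"
  and add: "h (a + b) = h a + h b"
  and mult: "h (a * b) = h a * h b"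
  using ring_hom by (auto simp: ring_hom_on_def)

lemma zero: "h 0 = 0"
  using add[of 0 0] by simp

lemma uminus: "h (- a) = - h a"
  using add[of a "- a"] by (simp add: zero add_eq_0_iff)

lemma diff: "h (a - b) = h a - h b"
  using add[of a "- b"] by (simp add: uminus)

lemma sum: "h (sum g A) = (\<Sum>x\<in>A. h (g x))"
  by (induction A rule: infinite_finite_induct) (auto simp: zero add)

lemma prod: "h (prod g A) = (\<Prod>x\<in>A. h (g x))"
  by (induction A rule: infinite_finite_induct) (auto simp: one mult)

lemma power: "h (a ^ n) = h a ^ n"
  by (induction n) (auto simp: one mult)

lemma of_nat: "h (of_nat n) = of_nat n"
  by (induction n) (auto simp: zero one add)

lemma of_int: "h (of_int n) = of_int n"
  by (cases n) (auto simp: of_nat uminus diff one)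

text \<open>The Leibniz formula contains the signs of permutations as integers, hence the use of
  \<open>of_int\<close>.\<close>

lemma det: "h (det M) = det (\<chi> i j. h (vec_nth (vec_nth M i) j))"
  by (simp add: det_def sum mult prod of_int)

lemma dvd_one: "a dvd 1 \<Longrightarrow> h a dvd 1"
  by (metis dvd_def mult one)

lemmas hom_simps = zero one add mult uminus diff sum prod power of_nat

end

lemma ring_hom_on_compose:
  assumes "ring_hom_on UNIV h" "ring_hom_on UNIV k"
  shows "ring_hom_on UNIV (\<lambda>x. k (h x))"
  using assms by (simp add: ring_hom_on_def)


section \<open>Polynomials\<close>

lemma mindex_induct [case_names zero add]:
  fixes \<alpha> :: "'n::finite mindex"
  assumes "P 0" and "\<And>\<beta> i. P \<beta> \<Longrightarrow> P (\<beta> + Poly_Mapping.single i 1)"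
  shows "P \<alpha>"
proof (induction \<alpha> rule: update_induct)
  case const
  then show ?case by (fact assms(1))
next
  case (update \<gamma> i k)
  have "Poly_Mapping.update i k \<gamma> = \<gamma> + Poly_Mapping.single i k"
    using update(1) by (intro poly_mapping_eqI)
      (auto simp: lookup_update lookup_add lookup_single in_keys_iff)
  moreover have "P (\<gamma> + Poly_Mapping.single i k)"
  proof (induction k)
    case 0
    then show ?case using update(3) by simp
  next
    case (Suc k)
    from assms(2)[OF this, of i] show ?case
      by (simp add: add.assoc single_add[symmetric])
  qed
  ultimately show ?case by simp
qed

text \<open>For properties that are additive but not evidently multiplicative in the polynomial;
  monomials are then built up one variable at a time by \<open>mindex_induct\<close>.\<close>

lemma mvpoly_induct_single [case_names single add]:
  assumes single: "\<And>\<alpha> c. P (Poly_Mapping.single \<alpha> c)" and add: "\<And>p q. P p \<Longrightarrow> P q \<Longrightarrow> P (p + q)"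
  shows "P (p :: ('n, 'a::comm_ring_1) mvpoly)"
proof (induction p rule: update_induct)
  case const
  show ?case using single[of 0 0] by simp
next
  case (update f a b)
  have "Poly_Mapping.update a b f = f + Poly_Mapping.single a b"
    using update(1) by (intro poly_mapping_eqI)
      (auto simp: lookup_update lookup_add lookup_single in_keys_iff)
  then show ?case using add[OF update(3) single] by simp
qed

lemma single_mindex_add_var:
  "Poly_Mapping.single (\<beta> + Poly_Mapping.single i 1) c = Poly_Mapping.single \<beta> c * pvar i"
  by (simp add: pvar_def mult_single)

lemma mvpoly_induct [case_names pconst pvar add mult]:
  assumes "\<And>c. P (pconst c)" "\<And>i. P (pvar i)"
    and "\<And>p q. P p \<Longrightarrow> P q \<Longrightarrow> P (p + q)" and "\<And>p q. P p \<Longrightarrow> P q \<Longrightarrow> P (p * q)"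
  shows "P (p :: ('n::finite, 'a::comm_ring_1) mvpoly)"
proof (induction p rule: mvpoly_induct_single)
  case (single \<alpha> c)
  show ?case
  proof (induction \<alpha> rule: mindex_induct)
    case zero
    show ?case using assms(1)[of c] by (simp add: pconst_def)
  next
    case (add \<beta> i)
    then show ?case unfolding single_mindex_add_var by (intro assms)
  qed
qed (rule assms)

lemma ring_hom_pconst: "ring_hom_on UNIV pconst"
  by (simp add: ring_hom_on_def pconst_def single_add mult_single)

interpretation pconst: ring_hom_UNIV pconst
  by unfold_locales (rule ring_hom_pconst)

section \<open>Monomials and evaluation homomorphisms\<close>

lemma mpow_zero [simp]: "mpow f 0 = 1"
  by (simp add: mpow_def)

lemma mpow_add: "mpow f (\<alpha> + \<beta>) = mpow f \<alpha> * mpow f \<beta>"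
  by (simp add: mpow_def lookup_add power_add prod.distrib)

lemma mpow_single: "mpow f (Poly_Mapping.single i k) = f i ^ k"
proof -
  have "mpow f (Poly_Mapping.single i k) = (\<Prod>j\<in>UNIV. if j = i then f i ^ k else 1)"
    unfolding mpow_def by (intro prod.cong) (auto simp: lookup_single)
  then show ?thesis by simp
qed

text \<open>Unlike \<open>psubst\<close>, this takes values in an arbitrary ring, since the Newton
  iteration evaluates the f_i at power series.\<close>

definition mv_eval ::
    "('a::comm_ring_1 \<Rightarrow> 'r::comm_ring_1) \<Rightarrow> ('n::finite \<Rightarrow> 'r) \<Rightarrow> ('n, 'a) mvpoly \<Rightarrow> 'r" where
  "mv_eval \<sigma> g p = (\<Sum>\<alpha>\<in>Poly_Mapping.keys p. \<sigma> (Poly_Mapping.lookup p \<alpha>) * mpow g \<alpha>)"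

lemma psubst_eq_mv_eval: "psubst g = mv_eval pconst g"
  by (simp add: fun_eq_iff psubst_def mv_eval_def)

context ring_hom_UNIV
begin

lemma mv_eval_add: "mv_eval h g (p + q) = mv_eval h g p + mv_eval h g q"
  unfolding mv_eval_def
  by (rule setsum_keys_plus_distrib) (auto simp: hom_simps algebra_simps)

lemma mv_eval_single: "mv_eval h g (Poly_Mapping.single \<alpha> c) = h c * mpow g \<alpha>"
  by (simp add: mv_eval_def zero)

lemma mv_eval_pconst [simp]: "mv_eval h g (pconst c) = h c"
  by (simp add: pconst_def mv_eval_single)

lemma mv_eval_pvar [simp]: "mv_eval h g (pvar i) = g i"
  by (simp add: pvar_def mv_eval_single one mpow_single)

lemma mv_eval_mult: "mv_eval h g (p * q) = mv_eval h g p * mv_eval h g q"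
proof (induction p rule: mvpoly_induct_single)
  case (single \<alpha> c)
  show ?case
  proof (induction q rule: mvpoly_induct_single)
    case (single \<beta> d)
    show ?case by (simp add: mult_single mv_eval_single mult mpow_add)
  qed (simp add: mv_eval_add algebra_simps)
qed (simp add: mv_eval_add algebra_simps)

lemma ring_hom_mv_eval: "ring_hom_on UNIV (mv_eval h g)"
  using mv_eval_pconst[of g 1]
  by (simp add: ring_hom_on_def mv_eval_add mv_eval_mult one pconst.one)

end

lemma ring_hom_psubst: "ring_hom_on UNIV (psubst g)"
  unfolding psubst_eq_mv_eval by (rule pconst.ring_hom_mv_eval)

interpretation psubst: ring_hom_UNIV "psubst g" for g
  by unfold_locales (rule ring_hom_psubst)

lemma psubst_pconst [simp]: "psubst g (pconst c) = pconst c"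
  and psubst_pvar [simp]: "psubst g (pvar i) = g i"
  by (simp_all add: psubst_eq_mv_eval)

lemma mv_eval_unique:
  fixes k :: "('n::finite, 'a::comm_ring_1) mvpoly \<Rightarrow> 'r::comm_ring_1"
  assumes k: "ring_hom_on UNIV k" and h: "ring_hom_on UNIV h"
    and c: "\<And>c. k (pconst c) = h (pconst c)" and v: "\<And>i. k (pvar i) = h (pvar i)"
  shows "k = h"
proof
  fix p show "k p = h p"
    using k h by (induction p rule: mvpoly_induct) (auto simp: c v ring_hom_on_def)
qed

section \<open>Partial derivatives and derivations\<close>

lemma pdiff_add: "pdiff j (p + q) = pdiff j p + pdiff j q"
  unfolding pdiff_def
  by (rule setsum_keys_plus_distrib) (auto simp: algebra_simps single_add)

lemma pdiff_single: "pdiff j (Poly_Mapping.single \<alpha> c) =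
    Poly_Mapping.single (\<alpha> - Poly_Mapping.single j 1) (of_nat (Poly_Mapping.lookup \<alpha> j) * c)"
  by (simp add: pdiff_def)

lemma pdiff_pconst: "pdiff j (pconst c) = 0"
  by (simp add: pconst_def pdiff_single)

lemma pdiff_single_mult_pvar:
  fixes \<beta> :: "'n::finite mindex" and c :: "'a::comm_ring_1"
  shows "pdiff j (Poly_Mapping.single \<beta> c * pvar i) =
    pdiff j (Poly_Mapping.single \<beta> c) * pvar i + (if i = j then Poly_Mapping.single \<beta> c else 0)"
proof -
  let ?e = "\<lambda>i. Poly_Mapping.single i (1::nat)"
  have eq: "pdiff j (Poly_Mapping.single \<beta> c * pvar i) =
    Poly_Mapping.single (\<beta> + ?e i - ?e j) (of_nat (Poly_Mapping.lookup \<beta> j + Poly_Mapping.lookup (?e i) j) * c)"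
    by (simp add: single_mindex_add_var[symmetric] pdiff_single lookup_add)
  have rhs: "pdiff j (Poly_Mapping.single \<beta> c) * pvar i =
    Poly_Mapping.single (\<beta> - ?e j + ?e i) (of_nat (Poly_Mapping.lookup \<beta> j) * c)"
    by (simp add: pdiff_single single_mindex_add_var del: One_nat_def)
  show ?thesis
  \<comment> \<open>If x_j does not occur in \<beta>, subtraction truncates only where the
    coefficient is zero; otherwise subtracting e_j commutes with adding e_i.\<close>
  proof (cases "Poly_Mapping.lookup \<beta> j = 0")
    case True
    then show ?thesis unfolding eq rhs by (auto simp: lookup_single)
  next
    case False
    then have "\<beta> + ?e i - ?e j = \<beta> - ?e j + ?e i"
      by (intro poly_mapping_eqI) (auto simp: lookup_add lookup_minus lookup_single when_def)
    then show ?thesis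
      unfolding eq rhs by (auto simp: lookup_single algebra_simps single_add)
  qed
qed

text \<open>Multiplying a monomial by one more variable produces the same Leibniz terms on both
  sides. The homomorphism \<sigma> is kept general because later it is the common constant term of
  two homomorphisms.\<close>

lemma derivation_eq_sum_pdiff:
  fixes D \<sigma> :: "('n::finite, 'a::comm_ring_1) mvpoly \<Rightarrow> 'r::comm_ring_1"
  assumes \<sigma>: "ring_hom_on UNIV \<sigma>"
    and add: "\<And>p q. D (p + q) = D p + D q"
    and mult: "\<And>p q. D (p * q) = D p * \<sigma> q + \<sigma> p * D q"
    and const: "\<And>c. D (pconst c) = 0"
  shows "D p = (\<Sum>j\<in>UNIV. \<sigma> (pdiff j p) * D (pvar j))"
proof -
  interpret \<sigma>: ring_hom_UNIV \<sigma> by unfold_locales (rule \<sigma>)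
  show ?thesis
  proof (induction p rule: mvpoly_induct_single)
    case (single \<alpha> c)
    show ?case
    proof (induction \<alpha> rule: mindex_induct)
      case zero
      show ?case using const[of c] by (simp add: pdiff_pconst[unfolded pconst_def] pconst_def \<sigma>.zero)
    next
      case (add \<beta> i)
      have "\<sigma> (pdiff j (Poly_Mapping.single \<beta> c * pvar i)) * D (pvar j) =
          \<sigma> (pvar i) * (\<sigma> (pdiff j (Poly_Mapping.single \<beta> c)) * D (pvar j)) +
          (if i = j then \<sigma> (Poly_Mapping.single \<beta> c) * D (pvar i) else 0)" for j
        unfolding pdiff_single_mult_pvar by (simp add: \<sigma>.hom_simps distrib_left distrib_right mult_ac)
      then show ?case
        unfolding single_mindex_add_var mult add
        by (simp add: sum.distrib sum_distrib_left mult.commute)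
    qed
  qed (simp add: add pdiff_add \<sigma>.add distrib_right sum.distrib)
qed


section \<open>Inverting a matrix with unit determinant\<close>

text \<open>Cramer's rule: the determinant with row k replaced by w is linear in w, and the
  coefficients of this linear form, divided by det A, are column k of the inverse.\<close>

lemma matrix_right_inverse_of_unit_det:
  fixes A :: "'r::comm_ring_1 ^ 'n ^ 'n"
  assumes "det A dvd 1"
  shows "\<exists>B :: 'r ^ 'n ^ 'n. A ** B = mat 1"
proof -
  obtain u where u: "det A * u = 1" using assms by (metis dvd_def)
  define C where "C k w = det ((\<chi> i. if i = k then w else row i A) :: 'r ^ 'n ^ 'n)" for k w
  \<comment> \<open>Putting row i of A at position k gives either A itself or a matrix with two
    equal rows.\<close>
  have C_row: "C k (row i A) = (if i = k then det A else 0)" for i k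
  proof (cases "i = k")
    case True
    have "(\<chi> l. if l = k then row k A else row l A) = A"
      by (simp add: vec_eq_iff row_def)
    then show ?thesis using True by (simp add: C_def)
  next
    case False
    then show ?thesis
      unfolding C_def
      by (simp, intro det_identical_rows[of i k]) (auto simp: row_def vec_eq_iff)
  qed
  have C_expand: "C k w = (\<Sum>j\<in>UNIV. vec_nth w j * C k (axis j 1))" for k w
  proof -
    have "w = (\<Sum>j\<in>UNIV. vec_nth w j *s axis j 1)"
      by (simp add: basis_expansion)
    then have "C k w = det ((\<chi> i. if i = k then (\<Sum>j\<in>UNIV. vec_nth w j *s axis j 1) else row i A) :: 'r ^ 'n ^ 'n)"
      unfolding C_def by (rule arg_cong)
    also have "\<dots> = (\<Sum>j\<in>UNIV. vec_nth w j * C k (axis j 1))"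
      unfolding C_def by (subst det_linear_row_sum) (simp_all add: det_row_mul)
    finally show ?thesis .
  qed
  define B where "B = (\<chi> j k. u * C k (axis j 1))"
  have "(\<Sum>j\<in>UNIV. vec_nth (vec_nth A i) j * vec_nth (vec_nth B j) k) = u * C k (row i A)" for i k
    by (subst C_expand) (simp add: B_def row_def sum_distrib_left mult.left_commute)
  then have "A ** B = mat 1"
    using u by (auto simp: vec_eq_iff matrix_matrix_mult_def mat_def C_row mult.commute)
  then show ?thesis by blast
qed

text \<open>By transposition. Uniqueness uses the left inverse of the Jacobian matrix, existence the
  right one.\<close>

lemma matrix_left_inverse_of_unit_det:
  fixes A :: "'r::comm_ring_1 ^ 'n ^ 'n"
  assumes "det A dvd 1"
  shows "\<exists>B :: 'r ^ 'n ^ 'n. B ** A = mat 1"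
proof -
  obtain B where "transpose A ** B = mat 1"
    using matrix_right_inverse_of_unit_det[of "transpose A"] assms by auto
  then have "transpose B ** A = mat 1"
    by (metis matrix_transpose_mul transpose_mat transpose_transpose)
  then show ?thesis by blast
qed


section \<open>Power series and the order filtration\<close>

lemma mfps_nth_simps [simp]:
  "mfps_nth 0 \<alpha> = 0"
  "mfps_nth (F + G) \<alpha> = mfps_nth F \<alpha> + mfps_nth G \<alpha>"
  "mfps_nth (- F) \<alpha> = - mfps_nth F \<alpha>"
  "mfps_nth (F - G) \<alpha> = mfps_nth F \<alpha> - mfps_nth G \<alpha>"
  "mfps_nth (mfps_map h F) \<alpha> = h (mfps_nth F \<alpha>)"
  by (simp_all add: zero_mfps_def plus_mfps_def uminus_mfps_def minus_mfps_def mfps_map_def)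

lemma mfps_nth_one: "mfps_nth 1 \<alpha> = (if \<alpha> = 0 then 1 else 0)"
  by (simp add: one_mfps_def)

lemma mfps_nth_const: "mfps_nth (mfps_const c) \<alpha> = (if \<alpha> = 0 then c else 0)"
  by (simp add: mfps_const_def)

lemma mfps_nth_var: "mfps_nth (mfps_var i) \<alpha> = (if \<alpha> = Poly_Mapping.single i 1 then 1 else 0)"
  by (simp add: mfps_var_def)

lemma mfps_nth_var_0 [simp]: "mfps_nth (mfps_var i) 0 = 0"
  by (metis mfps_nth_var lookup_single_eq lookup_zero one_neq_zero)

lemma mfps_nth_mult: "mfps_nth (F * G) \<alpha> =
    (\<Sum>(\<beta>, \<gamma>)\<in>{(\<beta>, \<gamma>). \<beta> + \<gamma> = \<alpha>}. mfps_nth F \<beta> * mfps_nth G \<gamma>)"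
  by (simp add: times_mfps_def)

lemma mfps_nth_sum [simp]: "mfps_nth (sum F A) \<alpha> = (\<Sum>x\<in>A. mfps_nth (F x) \<alpha>)"
  by (induction A rule: infinite_finite_induct) auto

lemma mfps_eqI: "(\<And>\<alpha>. mfps_nth F \<alpha> = mfps_nth G \<alpha>) \<Longrightarrow> F = G"
  by (simp add: mfps_eq_iff)

definition mdeg :: "'n::finite mindex \<Rightarrow> nat" where
  "mdeg \<alpha> = (\<Sum>i\<in>UNIV. Poly_Mapping.lookup \<alpha> i)"

lemma mdeg_zero [simp]: "mdeg 0 = 0"
  by (simp add: mdeg_def)

lemma mdeg_add [simp]: "mdeg (\<alpha> + \<beta>) = mdeg \<alpha> + mdeg \<beta>"
  by (simp add: mdeg_def lookup_add sum.distrib)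

lemma mdeg_eq_0_iff [simp]: "mdeg \<alpha> = 0 \<longleftrightarrow> \<alpha> = 0"
  by (auto simp: mdeg_def poly_mapping_eq_iff fun_eq_iff)

text \<open>Apart from \<alpha> + 0, every splitting of \<alpha> has a first summand of smaller
  degree. Thus the lowest coefficients see the second factor only through its constant term, which
  turns leading parts of differences into derivations.\<close>

lemma mfps_nth_mult_lowest:
  assumes "\<And>\<beta>. mdeg \<beta> < mdeg \<alpha> \<Longrightarrow> mfps_nth F \<beta> = 0"
  shows "mfps_nth (F * G) \<alpha> = mfps_nth F \<alpha> * mfps_nth G 0"
proof -
  have "mfps_nth F \<beta> * mfps_nth G \<gamma> = 0" if "\<beta> + \<gamma> = \<alpha>" "(\<beta>, \<gamma>) \<noteq> (\<alpha>, 0)" for \<beta> \<gamma>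
  proof -
    have "\<gamma> \<noteq> 0" using that by auto
    then have "mdeg \<beta> < mdeg \<alpha>" using that by (auto simp flip: mdeg_eq_0_iff)
    then show ?thesis by (simp add: assms)
  qed
  then have "(\<Sum>(\<beta>, \<gamma>)\<in>{(\<beta>, \<gamma>). \<beta> + \<gamma> = \<alpha>}. mfps_nth F \<beta> * mfps_nth G \<gamma>) =
      (\<Sum>(\<beta>, \<gamma>)\<in>{(\<alpha>, 0)}. mfps_nth F \<beta> * mfps_nth G \<gamma>)"
    by (intro sum.mono_neutral_right) auto
  then show ?thesis by (simp add: mfps_nth_mult)
qed

lemma mfps_nth_mult_0: "mfps_nth (F * G) 0 = mfps_nth F 0 * mfps_nth G 0"
  by (rule mfps_nth_mult_lowest) auto

lemma mfps_nth_const_mult [simp]: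
  fixes F :: "('n::finite, 'r::comm_ring_1) mfps"
  shows "mfps_nth (mfps_const c * F) \<alpha> = c * mfps_nth F \<alpha>"
proof -
  have "(\<Sum>(\<beta>, \<gamma>)\<in>{(\<beta>, \<gamma>). \<beta> + \<gamma> = \<alpha>}. mfps_nth (mfps_const c) \<beta> * mfps_nth F \<gamma>) =
      (\<Sum>(\<beta>, \<gamma>)\<in>{(0 :: 'n mindex, \<alpha>)}. mfps_nth (mfps_const c) \<beta> * mfps_nth F \<gamma>)"
    by (intro sum.mono_neutral_right) (auto simp: mfps_nth_const split: if_splits)
  then show ?thesis by (simp add: mfps_nth_mult mfps_nth_const)
qed

section \<open>Homomorphisms into power series rings, compared degree by degree\<close>

lemma ring_hom_mfps_nth_0: "ring_hom_on UNIV (\<lambda>F. mfps_nth F 0)"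
  by (simp add: ring_hom_on_def mfps_nth_mult_0 mfps_nth_one)

lemma ring_hom_mfps_const: "ring_hom_on UNIV mfps_const"
  by (auto simp: ring_hom_on_def mfps_eq_iff mfps_nth_const mfps_nth_one)

lemma ring_hom_mfps_map:
  assumes "ring_hom_on UNIV h"
  shows "ring_hom_on UNIV (mfps_map h)"
proof -
  interpret h: ring_hom_UNIV h by unfold_locales (rule assms)
  show ?thesis
    by (auto simp: ring_hom_on_def mfps_eq_iff mfps_nth_one mfps_nth_mult h.hom_simps split_def)
qed

text \<open>The coefficient of a product at \<alpha> involves only coefficients of at most the
  degree of \<alpha>, so agreement below degree d passes from the variables to all
  polynomials.\<close>

lemma hom_agree_below:
  fixes \<psi> \<psi>' :: "('n::finite, 'a::comm_ring_1) mvpoly \<Rightarrow> ('m::finite, 'r::comm_ring_1) mfps"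
  assumes hom: "ring_hom_on UNIV \<psi>" "ring_hom_on UNIV \<psi>'"
    and const: "\<And>c. \<psi> (pconst c) = \<psi>' (pconst c)"
    and var: "\<And>i \<alpha>. mdeg \<alpha> < d \<Longrightarrow> mfps_nth (\<psi> (pvar i)) \<alpha> = mfps_nth (\<psi>' (pvar i)) \<alpha>"
    and deg: "mdeg \<alpha> < d"
  shows "mfps_nth (\<psi> p) \<alpha> = mfps_nth (\<psi>' p) \<alpha>"
  using deg
proof (induction p arbitrary: \<alpha> rule: mvpoly_induct)
  case (mult p q)
  have "mfps_nth (\<psi> p * \<psi> q) \<alpha> = mfps_nth (\<psi>' p * \<psi>' q) \<alpha>"
    unfolding mfps_nth_mult
    by (rule sum.cong) (use mult.prems in \<open>auto intro!: arg_cong2[of _ _ _ _ "(*)"] mult.IH\<close>)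
  then show ?case using hom by (simp add: ring_hom_on_def)
qed (use hom const var in \<open>auto simp: ring_hom_on_def\<close>)

text \<open>
  The leading part of the difference of two homomorphisms is a derivation.  This replaces the
  Taylor expansion in the Newton iteration below.
\<close>

lemma hom_difference_leading:
  fixes \<psi> \<psi>' :: "('n::finite, 'a::comm_ring_1) mvpoly \<Rightarrow> ('m::finite, 'r::comm_ring_1) mfps"
  assumes hom: "ring_hom_on UNIV \<psi>" "ring_hom_on UNIV \<psi>'"
    and const: "\<And>c. \<psi> (pconst c) = \<psi>' (pconst c)"
    and \<sigma>: "\<And>p. mfps_nth (\<psi> p) 0 = \<sigma> p" "\<And>p. mfps_nth (\<psi>' p) 0 = \<sigma> p"
    and below: "\<And>p \<beta>. mdeg \<beta> < mdeg \<alpha> \<Longrightarrow> mfps_nth (\<psi> p) \<beta> = mfps_nth (\<psi>' p) \<beta>"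
  shows "mfps_nth (\<psi> p) \<alpha> - mfps_nth (\<psi>' p) \<alpha> =
    (\<Sum>j\<in>UNIV. \<sigma> (pdiff j p) * (mfps_nth (\<psi> (pvar j)) \<alpha> - mfps_nth (\<psi>' (pvar j)) \<alpha>))"
proof -
  interpret \<psi>: ring_hom_UNIV \<psi> by unfold_locales (rule hom)
  interpret \<psi>': ring_hom_UNIV \<psi>' by unfold_locales (rule hom)
  have "\<sigma> = (\<lambda>p. mfps_nth (\<psi> p) 0)" using \<sigma> by auto
  then have "ring_hom_on UNIV \<sigma>"
    using ring_hom_on_compose[OF hom(1) ring_hom_mfps_nth_0] by simp
  then show ?thesis
  proof (rule derivation_eq_sum_pdiff)
    fix p q
    \<comment> \<open>Each summand now has a factor whose coefficients vanish below the degree of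
      \<alpha>.\<close>
    have "\<psi> (p * q) - \<psi>' (p * q) = (\<psi> p - \<psi>' p) * \<psi> q + (\<psi> q - \<psi>' q) * \<psi>' p"
      by (simp add: \<psi>.mult \<psi>'.mult algebra_simps)
    then have "mfps_nth (\<psi> (p * q) - \<psi>' (p * q)) \<alpha> =
        mfps_nth ((\<psi> p - \<psi>' p) * \<psi> q) \<alpha> + mfps_nth ((\<psi> q - \<psi>' q) * \<psi>' p) \<alpha>"
      by simp
    also have "\<dots> = mfps_nth (\<psi> p - \<psi>' p) \<alpha> * \<sigma> q + mfps_nth (\<psi> q - \<psi>' q) \<alpha> * \<sigma> p"
      by (simp add: mfps_nth_mult_lowest below \<sigma>)
    finally show "mfps_nth (\<psi> (p * q)) \<alpha> - mfps_nth (\<psi>' (p * q)) \<alpha> =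
        (mfps_nth (\<psi> p) \<alpha> - mfps_nth (\<psi>' p) \<alpha>) * \<sigma> q +
        \<sigma> p * (mfps_nth (\<psi> q) \<alpha> - mfps_nth (\<psi>' q) \<alpha>)"
      by (simp add: mult.commute)
  qed (simp_all add: \<psi>.add \<psi>'.add const)
qed

text \<open>The target ring is arbitrary because three targets occur: A[x][[T]] for uniqueness,
  A'[x][[T]] for base change and A[x][[T]][[U]] for iterativity.\<close>

theorem hom_unique_of_jacobian:
  fixes \<psi> \<psi>' :: "('n::finite, 'a::comm_ring_1) mvpoly \<Rightarrow> ('m::finite, 'r::comm_ring_1) mfps"
  assumes jac: "det (poly_jacobian f) dvd 1"
    and hom: "ring_hom_on UNIV \<psi>" "ring_hom_on UNIV \<psi>'"
    and const: "\<And>c. \<psi> (pconst c) = \<psi>' (pconst c)"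
    and f: "\<And>i. \<psi> (f i) = \<psi>' (f i)"
    and \<sigma>: "\<And>p. mfps_nth (\<psi> p) 0 = mfps_nth (\<psi>' p) 0"
  shows "\<psi> = \<psi>'"
proof -
  define \<sigma> where "\<sigma> p = mfps_nth (\<psi> p) 0" for p
  interpret \<sigma>: ring_hom_UNIV \<sigma>
    unfolding \<sigma>_def by unfold_locales (rule ring_hom_on_compose[OF hom(1) ring_hom_mfps_nth_0])
  obtain B where B: "B ** poly_jacobian f = mat 1"
    using matrix_left_inverse_of_unit_det[OF jac] by blast
  have \<sigma>B: "(\<Sum>i\<in>UNIV. \<sigma> (vec_nth (vec_nth B k) i) * \<sigma> (pdiff j (f i))) = (if k = j then 1 else 0)"
    for k j
  proof -
    have "(\<Sum>i\<in>UNIV. vec_nth (vec_nth B k) i * pdiff j (f i)) = (if k = j then 1 else 0)"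
      using B by (auto simp: vec_eq_iff matrix_matrix_mult_def mat_def poly_jacobian_def)
    from arg_cong[OF this, of \<sigma>] show ?thesis
      by (simp add: \<sigma>.hom_simps split: if_splits)
  qed
  have agree: "mfps_nth (\<psi> p) \<alpha> = mfps_nth (\<psi>' p) \<alpha>" for p \<alpha>
  proof (induction "mdeg \<alpha>" arbitrary: p \<alpha> rule: less_induct)
    case less
    let ?D = "\<lambda>p. mfps_nth (\<psi> p) \<alpha> - mfps_nth (\<psi>' p) \<alpha>"
    have D: "?D p = (\<Sum>j\<in>UNIV. \<sigma> (pdiff j p) * ?D (pvar j))" for p
      by (rule hom_difference_leading) (simp_all add: hom const \<sigma> \<sigma>_def less)
    \<comment> \<open>The leading difference D satisfies \<sigma>(J) D(x) = D(f) = 0, and by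
      \<open>\<sigma>B\<close> the matrix \<sigma>(B) is a left inverse of \<sigma>(J).\<close>
    have "?D (pvar k) = 0" for k
    proof -
      have "?D (pvar k) = (\<Sum>j\<in>UNIV. (if k = j then 1 else 0) * ?D (pvar j))"
        by (simp add: if_distrib[of "\<lambda>x. x * _"] cong: if_cong)
      also have "\<dots> = (\<Sum>j\<in>UNIV. \<Sum>i\<in>UNIV. \<sigma> (vec_nth (vec_nth B k) i) * (\<sigma> (pdiff j (f i)) * ?D (pvar j)))"
        unfolding \<sigma>B[symmetric] by (simp add: sum_distrib_right mult.assoc)
      also have "\<dots> = (\<Sum>i\<in>UNIV. \<sigma> (vec_nth (vec_nth B k) i) * ?D (f i))"
        by (subst sum.swap) (simp add: D[of "f _"] sum_distrib_left)
      finally show ?thesis by (simp add: f)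
    qed
    then show ?case using D[of p] by simp
  qed
  show ?thesis
    by (intro ext mfps_eqI agree)
qed

text \<open>Newton's method with the fixed inverse M of the Jacobian matrix at x, not recomputed at
  each approximation. The residual then gains one degree per step, which suffices.\<close>

theorem exists_mfps_solution:
  fixes f :: "'n::finite \<Rightarrow> ('n, 'a::comm_ring_1) mvpoly"
  assumes jac: "det (poly_jacobian f) dvd 1"
  shows "\<exists>\<xi>. (\<forall>j. mfps_nth (\<xi> j) 0 = pvar j) \<and>
    (\<forall>i. mv_eval (\<lambda>c. mfps_const (pconst c)) \<xi> (f i) = mfps_const (f i) + mfps_var i)"
proof -
  obtain M where M: "poly_jacobian f ** M = mat 1"
    using matrix_right_inverse_of_unit_det[OF jac] by blast
  have JM: "(\<Sum>j\<in>UNIV. pdiff j (f i) * vec_nth (vec_nth M j) k) = (if i = k then 1 else 0)" for i k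
    using M by (auto simp: vec_eq_iff matrix_matrix_mult_def mat_def poly_jacobian_def)
  define ev where "ev \<xi> = mv_eval (\<lambda>c. mfps_const (pconst c)) \<xi>"
    for \<xi> :: "'n \<Rightarrow> ('n, ('n, 'a) mvpoly) mfps"
  define r where "r \<xi> i = ev \<xi> (f i) - mfps_const (f i) - mfps_var i" for \<xi> i
  define step where "step \<xi> j = \<xi> j - (\<Sum>k\<in>UNIV. mfps_const (vec_nth (vec_nth M j) k) * r \<xi> k)" for \<xi> j
  define X where "X m = (step ^^ m) (\<lambda>j. mfps_const (pvar j))" for m
  interpret c: ring_hom_UNIV "\<lambda>c::'a. mfps_const (pconst c) :: ('n, ('n, 'a) mvpoly) mfps"
    by unfold_locales (rule ring_hom_on_compose[OF ring_hom_pconst ring_hom_mfps_const])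
  have ev_hom: "ring_hom_on UNIV (ev \<xi>)" for \<xi>
    unfolding ev_def by (rule c.ring_hom_mv_eval)
  have ev_const: "ev \<xi> (pconst a) = mfps_const (pconst a)" and ev_var: "ev \<xi> (pvar j) = \<xi> j" for \<xi> a j
    by (simp_all add: ev_def)
  have ev_0: "mfps_nth (ev \<xi> p) 0 = p" if "\<And>j. mfps_nth (\<xi> j) 0 = pvar j" for \<xi> p
  proof -
    have "(\<lambda>p. mfps_nth (ev \<xi> p) 0) = (\<lambda>p. p)"
      by (rule mv_eval_unique[OF ring_hom_on_compose[OF ev_hom ring_hom_mfps_nth_0]])
        (simp_all add: ring_hom_on_def ev_const ev_var that mfps_nth_const)
    then show ?thesis by (rule fun_cong)
  qed
  have ev_agree: "mfps_nth (ev \<xi> p) \<alpha> = mfps_nth (ev \<xi>' p) \<alpha>"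
    if "\<And>j \<alpha>. mdeg \<alpha> < d \<Longrightarrow> mfps_nth (\<xi> j) \<alpha> = mfps_nth (\<xi>' j) \<alpha>" "mdeg \<alpha> < d" for \<xi> \<xi>' d p \<alpha>
    by (rule hom_agree_below[OF ev_hom ev_hom, where d = d]) (simp_all add: ev_const ev_var that)
  \<comment> \<open>After m steps the residual vanishes through degree m, and the constant terms are
    still the variables.\<close>
  have X: "(\<forall>j. mfps_nth (X m j) 0 = pvar j) \<and> (\<forall>i \<alpha>. mdeg \<alpha> \<le> m \<longrightarrow> mfps_nth (r (X m) i) \<alpha> = 0)" for m
  proof (induction m)
    case 0
    have X0: "mfps_nth (X 0 j) 0 = pvar j" for j
      by (simp add: X_def mfps_nth_const)
    then show ?case
      by (auto simp: r_def ev_0[OF X0] mfps_nth_const)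
  next
    case (Suc m)
    have XS: "X (Suc m) = step (X m)" by (simp add: X_def)
    have dX: "mfps_nth (X (Suc m) j) \<alpha> = mfps_nth (X m j) \<alpha> -
        (\<Sum>k\<in>UNIV. vec_nth (vec_nth M j) k * mfps_nth (r (X m) k) \<alpha>)" for j \<alpha>
      by (simp add: XS step_def)
    have same: "mfps_nth (X (Suc m) j) \<alpha> = mfps_nth (X m j) \<alpha>" if "mdeg \<alpha> < Suc m" for j \<alpha>
      using Suc that by (simp add: dX)
    have X0: "mfps_nth (X m j) 0 = pvar j" "mfps_nth (X (Suc m) j) 0 = pvar j" for j
      using Suc same by auto
    have "mfps_nth (r (X (Suc m)) i) \<alpha> = 0" if \<alpha>: "mdeg \<alpha> \<le> Suc m" for i \<alpha>
    proof (cases "mdeg \<alpha> < Suc m")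
      case True
      have "mfps_nth (ev (X (Suc m)) (f i)) \<alpha> = mfps_nth (ev (X m) (f i)) \<alpha>"
        using same True by (rule ev_agree)
      then have "mfps_nth (r (X (Suc m)) i) \<alpha> = mfps_nth (r (X m) i) \<alpha>"
        by (simp add: r_def)
      then show ?thesis using Suc True by simp
    next
      case False
      then have deg: "mdeg \<alpha> = Suc m" using \<alpha> by simp
      \<comment> \<open>In degree m + 1 the correction - M r changes the value of f by - J M r = -
        r, cancelling the old residual.\<close>
      have "mfps_nth (ev (X (Suc m)) (f i)) \<alpha> - mfps_nth (ev (X m) (f i)) \<alpha> =
          (\<Sum>j\<in>UNIV. pdiff j (f i) *
            (mfps_nth (ev (X (Suc m)) (pvar j)) \<alpha> - mfps_nth (ev (X m) (pvar j)) \<alpha>))"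
        by (rule hom_difference_leading[OF ev_hom ev_hom])
          (simp_all add: ev_const ev_0 X0 deg ev_agree[OF same])
      also have "\<dots> = - (\<Sum>j\<in>UNIV. \<Sum>k\<in>UNIV. pdiff j (f i) * vec_nth (vec_nth M j) k * mfps_nth (r (X m) k) \<alpha>)"
        by (simp add: ev_var dX sum_distrib_left sum_negf mult.assoc)
      also have "\<dots> = - (\<Sum>k\<in>UNIV. (\<Sum>j\<in>UNIV. pdiff j (f i) * vec_nth (vec_nth M j) k) * mfps_nth (r (X m) k) \<alpha>)"
        by (subst sum.swap) (simp add: sum_distrib_right)
      also have "\<dots> = - mfps_nth (r (X m) i) \<alpha>"
        unfolding JM by (simp add: if_distrib[of "\<lambda>x. x * _"] cong: if_cong)
      finally show ?thesis by (simp add: r_def)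
    qed
    then show ?case using X0 by blast
  qed
  have stable: "mfps_nth (X (m + k) j) \<alpha> = mfps_nth (X m j) \<alpha>" if "mdeg \<alpha> \<le> m" for m k j \<alpha>
  proof (induction k)
    case (Suc k)
    have "mfps_nth (X (Suc (m + k)) j) \<alpha> = mfps_nth (X (m + k) j) \<alpha>"
      using X[of "m + k"] that by (simp add: X_def step_def)
    then show ?case using Suc by simp
  qed simp
  \<comment> \<open>Coefficients of degree at most m are constant from stage m on, so the limit
    reads each coefficient at the stage equal to its degree.\<close>
  define \<xi> where "\<xi> j = Abs_mfps (\<lambda>\<alpha>. mfps_nth (X (mdeg \<alpha>) j) \<alpha>)" for j
  have \<xi>: "mfps_nth (\<xi> j) \<alpha> = mfps_nth (X m j) \<alpha>" if "mdeg \<alpha> < Suc m" for j m \<alpha>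
    using stable[of \<alpha> "mdeg \<alpha>" "m - mdeg \<alpha>" j] that by (simp add: \<xi>_def)
  have "mfps_nth (ev \<xi> (f i)) \<alpha> = mfps_nth (mfps_const (f i) + mfps_var i) \<alpha>" for i \<alpha>
  proof -
    have "mfps_nth (ev \<xi> (f i)) \<alpha> = mfps_nth (ev (X (mdeg \<alpha>)) (f i)) \<alpha>"
      by (rule ev_agree[where d = "Suc (mdeg \<alpha>)"]) (simp_all add: \<xi>)
    then show ?thesis using X[of "mdeg \<alpha>"] by (simp add: r_def algebra_simps)
  qed
  moreover have "mfps_nth (\<xi> j) 0 = pvar j" for j
    using X[of 0] \<xi>[of 0 0] by simp
  ultimately show ?thesis unfolding ev_def by (metis mfps_eqI)
qed


section \<open>The extended higher derivation\<close>

text \<open>A working substitute for \<open>is_theta_extension\<close> that speaks only of constants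
  and the f_i and avoids the definite description in \<open>theta_subalg\<close>.\<close>

definition is_theta_hom ::
    "('n::finite \<Rightarrow> ('n, 'a::comm_ring_1) mvpoly) \<Rightarrow>
     (('n, 'a) mvpoly \<Rightarrow> ('n, ('n, 'a) mvpoly) mfps) \<Rightarrow> bool" where
  "is_theta_hom f \<theta> \<longleftrightarrow> ring_hom_on UNIV \<theta> \<and> (\<forall>r. mfps_nth (\<theta> r) 0 = r) \<and>
     (\<forall>c. \<theta> (pconst c) = mfps_const (pconst c)) \<and>
     (\<forall>i. \<theta> (f i) = mfps_const (f i) + mfps_var i)"

lemma is_theta_homD:
  assumes "is_theta_hom f \<theta>"
  shows "ring_hom_on UNIV \<theta>" "mfps_nth (\<theta> r) 0 = r"
    "\<theta> (pconst c) = mfps_const (pconst c)" "\<theta> (f i) = mfps_const (f i) + mfps_var i"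
  using assms by (auto simp: is_theta_hom_def)

lemma exists_theta_hom:
  assumes jac: "det (poly_jacobian f) dvd 1"
  shows "\<exists>\<theta>. is_theta_hom f \<theta>"
proof -
  obtain \<xi> where \<xi>: "\<And>j. mfps_nth (\<xi> j) 0 = pvar j"
    "\<And>i. mv_eval (\<lambda>c. mfps_const (pconst c)) \<xi> (f i) = mfps_const (f i) + mfps_var i"
    using exists_mfps_solution[OF jac] by auto
  interpret c: ring_hom_UNIV "\<lambda>c. mfps_const (pconst c)"
    by unfold_locales (rule ring_hom_on_compose[OF ring_hom_pconst ring_hom_mfps_const])
  let ?\<theta> = "mv_eval (\<lambda>c. mfps_const (pconst c)) \<xi>"
  have "(\<lambda>p. mfps_nth (?\<theta> p) 0) = (\<lambda>p. p)"
    by (rule mv_eval_unique[OF ring_hom_on_compose[OF c.ring_hom_mv_eval ring_hom_mfps_nth_0]])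
      (simp_all add: ring_hom_on_def \<xi> mfps_nth_const)
  then have "is_theta_hom f ?\<theta>"
    by (simp add: is_theta_hom_def \<xi> c.ring_hom_mv_eval fun_eq_iff)
  then show ?thesis by blast
qed

lemma theta_hom_unique:
  assumes jac: "det (poly_jacobian f) dvd 1" and "is_theta_hom f \<theta>" "is_theta_hom f \<theta>'"
  shows "\<theta> = \<theta>'"
  by (rule hom_unique_of_jacobian[OF jac]) (simp_all add: is_theta_homD[OF assms(2)] is_theta_homD[OF assms(3)])

section \<open>The subalgebra A[f] and the derivation on it\<close>

lemma subalg_pconst [simp]: "pconst c \<in> subalg f"
  and subalg_gen [simp]: "f i \<in> subalg f"
  unfolding subalg_def by (metis psubst_pconst rangeI) (metis psubst_pvar rangeI)

lemma subalg_add: "a \<in> subalg f \<Longrightarrow> b \<in> subalg f \<Longrightarrow> a + b \<in> subalg f"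
  and subalg_mult: "a \<in> subalg f \<Longrightarrow> b \<in> subalg f \<Longrightarrow> a * b \<in> subalg f"
  unfolding subalg_def by (auto simp flip: psubst.add psubst.mult)

lemma subalg_0 [simp]: "0 \<in> subalg f" and subalg_1 [simp]: "1 \<in> subalg f"
  using subalg_pconst[of 0 f] subalg_pconst[of 1 f] by (simp_all add: pconst.hom_simps)

lemma subalg_sum: "(\<And>x. x \<in> A \<Longrightarrow> g x \<in> subalg f) \<Longrightarrow> sum g A \<in> subalg f"
  by (induction A rule: infinite_finite_induct) (auto intro: subalg_add)

text \<open>The coefficients of \<theta>(f_i) are f_i, 1 and 0, and products are convolutions, so
  membership in A[f] spreads from the generators.\<close>

lemma theta_hom_subalg:
  assumes \<theta>: "is_theta_hom f \<theta>" and "g \<in> subalg f"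
  shows "mfps_nth (\<theta> g) \<alpha> \<in> subalg f"
proof -
  interpret \<theta>: ring_hom_UNIV \<theta> by unfold_locales (rule is_theta_homD[OF \<theta>])
  have "mfps_nth (\<theta> (psubst f p)) \<alpha> \<in> subalg f" for p
  proof (induction p arbitrary: \<alpha> rule: mvpoly_induct)
    case (mult p q)
    then show ?case
      by (auto simp: psubst.mult \<theta>.mult mfps_nth_mult intro!: subalg_sum subalg_mult)
  qed (auto simp: is_theta_homD[OF \<theta>] mfps_nth_const mfps_nth_var psubst.add \<theta>.add intro!: subalg_add)
  then show ?thesis using assms(2) by (auto simp: subalg_def)
qed

lemma theta_hom_is_theta_subalg:
  assumes \<theta>: "is_theta_hom f \<theta>"
  shows "is_theta_subalg f (restrict \<theta> (subalg f))"
  using is_theta_homD[OF \<theta>] theta_hom_subalg[OF \<theta>]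
  by (auto simp: is_theta_subalg_def mfps_over_def ring_hom_on_def subalg_add subalg_mult)

lemma is_theta_subalg_unique:
  assumes \<theta>: "is_theta_subalg f \<theta>" and \<theta>': "is_theta_subalg f \<theta>'"
  shows "\<theta> = \<theta>'"
proof
  fix g
  have "\<theta> (psubst f p) = \<theta>' (psubst f p)" for p
  proof (induction p rule: mvpoly_induct)
    case (add p q)
    then show ?case using \<theta> \<theta>'
      by (auto simp: is_theta_subalg_def psubst.add ring_hom_on_def subalg_def)
  next
    case (mult p q)
    then show ?case using \<theta> \<theta>'
      by (auto simp: is_theta_subalg_def psubst.mult ring_hom_on_def subalg_def)
  qed (use \<theta> \<theta>' in \<open>auto simp: is_theta_subalg_def\<close>)
  then show "\<theta> g = \<theta>' g"
    using \<theta> \<theta>' by (cases "g \<in> subalg f")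
      (auto simp: is_theta_subalg_def subalg_def PiE_def extensional_def)
qed

lemma theta_subalg_eq:
  assumes "is_theta_hom f \<theta>"
  shows "theta_subalg f = restrict \<theta> (subalg f)"
  unfolding theta_subalg_def
  by (rule the_equality) (use assms theta_hom_is_theta_subalg is_theta_subalg_unique in blast)+

lemma is_theta_extension_iff:
  assumes jac: "det (poly_jacobian f) dvd 1"
  shows "is_theta_extension f \<theta> \<longleftrightarrow> is_theta_hom f \<theta>"
proof
  assume ext: "is_theta_extension f \<theta>"
  \<comment> \<open>Existence identifies \<open>theta_subalg\<close> with a restriction of
    \<theta>', whose values at the constants and the f_i are known.\<close>
  obtain \<theta>' where \<theta>': "is_theta_hom f \<theta>'" using exists_theta_hom[OF jac] by blast
  have "\<theta> g = \<theta>' g" if "g \<in> subalg f" for g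
    using ext that by (simp add: is_theta_extension_def theta_subalg_eq[OF \<theta>'])
  then show "is_theta_hom f \<theta>"
    using ext \<theta>' by (simp add: is_theta_hom_def is_theta_extension_def higher_derivation_on_def)
next
  assume "is_theta_hom f \<theta>"
  then show "is_theta_extension f \<theta>"
    by (simp add: is_theta_extension_def theta_subalg_eq higher_derivation_on_def is_theta_homD
        mfps_over_def)
qed

lemma ex1_theta_extension:
  assumes jac: "det (poly_jacobian f) dvd 1"
  shows "\<exists>!\<theta>. is_theta_extension f \<theta>"
  unfolding is_theta_extension_iff[OF jac]
  using exists_theta_hom[OF jac] theta_hom_unique[OF jac] by blast

lemma theta_hom_theta:
  assumes jac: "det (poly_jacobian f) dvd 1"
  shows "is_theta_hom f (theta f)"
  using theI'[OF ex1_theta_extension[OF jac]]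
  by (simp add: is_theta_extension_iff[OF jac] theta_def)


section \<open>Iterativity\<close>

lemma mbinom_refl [simp]: "mbinom \<alpha> \<alpha> = 1"
  and mbinom_zero [simp]: "mbinom \<alpha> 0 = 1"
  by (simp_all add: mbinom_def)

lemma mbinom_eq_0:
  assumes "\<nexists>\<beta>. \<gamma> = \<alpha> + \<beta>"
  shows "mbinom \<gamma> \<alpha> = 0"
proof -
  have "\<exists>i. Poly_Mapping.lookup \<gamma> i < Poly_Mapping.lookup \<alpha> i"
  proof (rule ccontr)
    assume "\<not> ?thesis"
    then have "\<gamma> = \<alpha> + (\<gamma> - \<alpha>)"
      by (intro poly_mapping_eqI) (auto simp: lookup_add lookup_minus not_less)
    then show False using assms by blast
  qed
  then show ?thesis unfolding mbinom_def by (auto simp: prod_zero_iff)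
qed

text \<open>The one-variable Vandermonde identity in each coordinate. Expanding the product of sums
  gives a choice of k \<le> \<alpha>_i for every i, which is a splitting of \<alpha>.\<close>

lemma mbinom_vandermonde:
  fixes \<alpha> \<gamma> \<delta> :: "'n::finite mindex"
  shows "(\<Sum>(\<beta>, \<beta>')\<in>{(\<beta>, \<beta>'). \<beta> + \<beta>' = \<alpha>}. mbinom \<gamma> \<beta> * mbinom \<delta> \<beta>') = mbinom (\<gamma> + \<delta>) \<alpha>"
proof -
  let ?l = "Poly_Mapping.lookup"
  have "mbinom (\<gamma> + \<delta>) \<alpha> = (\<Prod>i\<in>UNIV. \<Sum>k\<le>?l \<alpha> i. (?l \<gamma> i choose k) * (?l \<delta> i choose (?l \<alpha> i - k)))"
    by (simp add: mbinom_def lookup_add vandermonde)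
  also have "\<dots> = (\<Sum>g\<in>(\<Pi>\<^sub>E i\<in>UNIV. {..?l \<alpha> i}). \<Prod>i\<in>UNIV. (?l \<gamma> i choose g i) * (?l \<delta> i choose (?l \<alpha> i - g i)))"
    by (rule prod_sum_PiE) auto
  also have "\<dots> = (\<Sum>(\<beta>, \<beta>')\<in>{(\<beta>, \<beta>'). \<beta> + \<beta>' = \<alpha>}. mbinom \<gamma> \<beta> * mbinom \<delta> \<beta>')"
    by (rule sum.reindex_bij_witness[where
          i = "\<lambda>(\<beta>, \<beta>'). ?l \<beta>" and
          j = "\<lambda>g. (Abs_poly_mapping g, Abs_poly_mapping (\<lambda>i. ?l \<alpha> i - g i))"])
      (auto simp: mbinom_def lookup_add prod.distrib PiE_iff intro!: poly_mapping_eqI)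
  finally show ?thesis by simp
qed

section \<open>The substitution of T + U for T\<close>

lemma single_eq_zero_iff [simp]: "Poly_Mapping.single i c = 0 \<longleftrightarrow> c = 0"
  by (metis lookup_single_eq lookup_zero single_zero)

text \<open>The substitution \<open>F(T) \<mapsto> F(T + U)\<close>, with \<open>U\<close> the outer variables of \<open>R[[T]][[U]]\<close>.\<close>

definition mfps_double :: "('n::finite, 'r::comm_ring_1) mfps \<Rightarrow> ('n, ('n, 'r) mfps) mfps" where
  "mfps_double F =
    Abs_mfps (\<lambda>\<beta>. Abs_mfps (\<lambda>\<alpha>. of_nat (mbinom (\<alpha> + \<beta>) \<alpha>) * mfps_nth F (\<alpha> + \<beta>)))"

lemma mfps_nth_double [simp]:
  "mfps_nth (mfps_nth (mfps_double F) \<beta>) \<alpha> = of_nat (mbinom (\<alpha> + \<beta>) \<alpha>) * mfps_nth F (\<alpha> + \<beta>)"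
  by (simp add: mfps_double_def)

lemma mindex_add_eq_0_iff: "\<alpha> + \<beta> = 0 \<longleftrightarrow> \<alpha> = 0 \<and> \<beta> = (0 :: 'n::finite mindex)"
  by (metis add_is_0 mdeg_add mdeg_eq_0_iff)

text \<open>Used twice: for the splittings of e_i in \<open>mfps_double_var\<close>, and for
  products of series restricted to the i-th axis.\<close>

lemma mindex_add_eq_single:
  fixes \<alpha> \<beta> :: "'n::finite mindex"
  assumes "\<alpha> + \<beta> = Poly_Mapping.single i n"
  shows "\<alpha> = Poly_Mapping.single i (Poly_Mapping.lookup \<alpha> i)"
proof (rule poly_mapping_eqI)
  fix j
  have "Poly_Mapping.lookup \<alpha> j + Poly_Mapping.lookup \<beta> j = Poly_Mapping.lookup (Poly_Mapping.single i n) j"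
    using assms by (metis lookup_add)
  then show "Poly_Mapping.lookup \<alpha> j =
      Poly_Mapping.lookup (Poly_Mapping.single i (Poly_Mapping.lookup \<alpha> i)) j"
    by (auto simp: lookup_single when_def split: if_splits)
qed

lemma ring_hom_mfps_double: "ring_hom_on UNIV (mfps_double :: ('n::finite, 'r::comm_ring_1) mfps \<Rightarrow> _)"
  unfolding ring_hom_on_def
proof (intro conjI ballI)
  show "mfps_double (1 :: ('n, 'r) mfps) = 1"
    by (auto simp: mfps_eq_iff mfps_nth_one mindex_add_eq_0_iff)
next
  fix F G :: "('n, 'r) mfps"
  show "mfps_double (F + G) = mfps_double F + mfps_double G"
    by (simp add: mfps_eq_iff algebra_simps)
  let ?P = "\<lambda>\<alpha>::'n mindex. {(\<beta>, \<gamma>). \<beta> + \<gamma> = \<alpha>}"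
  have "mfps_nth (mfps_nth (mfps_double F * mfps_double G) \<nu>) \<mu> =
      mfps_nth (mfps_nth (mfps_double (F * G)) \<nu>) \<mu>" for \<mu> \<nu>
  proof -
    let ?B = "\<lambda>\<gamma> \<alpha>. of_nat (mbinom \<gamma> \<alpha>) :: 'r"
    let ?h = "\<lambda>\<gamma> \<gamma>' \<alpha> \<alpha>'. ?B \<gamma> \<alpha> * ?B \<gamma>' \<alpha>' * (mfps_nth F \<gamma> * mfps_nth G \<gamma>')"
    have "mfps_nth (mfps_nth (mfps_double F * mfps_double G) \<nu>) \<mu> =
        (\<Sum>((\<beta>, \<beta>'), (\<alpha>, \<alpha>'))\<in>?P \<nu> \<times> ?P \<mu>. ?h (\<alpha> + \<beta>) (\<alpha>' + \<beta>') \<alpha> \<alpha>')"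
      by (simp add: mfps_nth_mult sum.cartesian_product' split_def sum_product mult_ac)
    \<comment> \<open>The new indices are the totals \<gamma> = \<alpha> + \<beta> and \<gamma>' =
      \<alpha>' + \<beta>'; only those dominating \<alpha> and \<alpha>' arise.\<close>
    also have "\<dots> = (\<Sum>((\<gamma>, \<gamma>'), (\<alpha>, \<alpha>'))\<in>{((\<gamma>, \<gamma>'), (\<alpha>, \<alpha>')) \<in> ?P (\<mu> + \<nu>) \<times> ?P \<mu>.
        (\<exists>\<delta>. \<gamma> = \<alpha> + \<delta>) \<and> (\<exists>\<delta>. \<gamma>' = \<alpha>' + \<delta>)}. ?h \<gamma> \<gamma>' \<alpha> \<alpha>')"
      by (rule sum.reindex_bij_witness[where
            i = "\<lambda>((\<gamma>, \<gamma>'), (\<alpha>, \<alpha>')). ((\<gamma> - \<alpha>, \<gamma>' - \<alpha>'), (\<alpha>, \<alpha>'))" and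
            j = "\<lambda>((\<beta>, \<beta>'), (\<alpha>, \<alpha>')). ((\<alpha> + \<beta>, \<alpha>' + \<beta>'), (\<alpha>, \<alpha>'))"])
        (auto simp: ac_simps intro: add.commute)
    \<comment> \<open>The added terms vanish by \<open>mbinom_eq_0\<close>. Now \<alpha> and
      \<alpha>' occur only in the binomials, and Vandermonde applies.\<close>
    also have "\<dots> = (\<Sum>((\<gamma>, \<gamma>'), (\<alpha>, \<alpha>'))\<in>?P (\<mu> + \<nu>) \<times> ?P \<mu>. ?h \<gamma> \<gamma>' \<alpha> \<alpha>')"
      by (rule sum.mono_neutral_left, auto)
        (metis mbinom_eq_0 mult_zero_left mult_zero_right of_nat_0)+
    also have "\<dots> = (\<Sum>(\<gamma>, \<gamma>')\<in>?P (\<mu> + \<nu>).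
        of_nat (\<Sum>(\<alpha>, \<alpha>')\<in>?P \<mu>. mbinom \<gamma> \<alpha> * mbinom \<gamma>' \<alpha>') * (mfps_nth F \<gamma> * mfps_nth G \<gamma>'))"
      by (simp add: sum.cartesian_product' split_def sum_distrib_right)
    also have "\<dots> = mfps_nth (mfps_nth (mfps_double (F * G)) \<nu>) \<mu>"
      unfolding mbinom_vandermonde mfps_nth_double mfps_nth_mult sum_distrib_left
      by (rule sum.cong) auto
    finally show ?thesis .
  qed
  then show "mfps_double (F * G) = mfps_double F * mfps_double G"
    by (simp add: mfps_eq_iff)
qed

lemma mfps_double_const: "mfps_double (mfps_const c) = mfps_const (mfps_const c)"
  by (auto simp: mfps_eq_iff mfps_nth_const mindex_add_eq_0_iff)

lemma mfps_double_var:
  "mfps_double (mfps_var i) = mfps_const (mfps_var i) + (mfps_var i :: ('n::finite, ('n, 'r::comm_ring_1) mfps) mfps)"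
proof (intro mfps_eqI)
  fix \<alpha> \<beta> :: "'n mindex"
  show "mfps_nth (mfps_nth (mfps_double (mfps_var i :: ('n, 'r) mfps)) \<beta>) \<alpha> =
      mfps_nth (mfps_nth (mfps_const (mfps_var i) + mfps_var i) \<beta>) \<alpha>"
  proof (cases "\<alpha> + \<beta> = Poly_Mapping.single i 1")
    case True
    then have "Poly_Mapping.lookup \<alpha> i + Poly_Mapping.lookup \<beta> i = 1"
      by (metis lookup_add lookup_single_eq)
    moreover have "\<alpha> = Poly_Mapping.single i (Poly_Mapping.lookup \<alpha> i)"
      "\<beta> = Poly_Mapping.single i (Poly_Mapping.lookup \<beta> i)"
      using mindex_add_eq_single[OF True] mindex_add_eq_single[of \<beta> \<alpha> i 1] True
      by (simp_all add: add.commute)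
    \<comment> \<open>The splitting 0 + e_i yields the outer variable U_i, and e_i + 0 the inner
      variable T_i.\<close>
    ultimately have "\<alpha> = 0 \<and> \<beta> = Poly_Mapping.single i 1 \<or> \<alpha> = Poly_Mapping.single i 1 \<and> \<beta> = 0"
      by (metis add_is_1 One_nat_def single_zero)
    then show ?thesis
      by (auto simp: mfps_nth_var mfps_nth_const mfps_nth_one)
  next
    case False
    then show ?thesis
      by (auto simp: mfps_nth_var mfps_nth_const mfps_nth_one)
  qed
qed

context ring_hom_UNIV
begin

lemma mfps_map_const: "mfps_map h (mfps_const c) = mfps_const (h c)"
  by (auto simp: mfps_eq_iff mfps_nth_const zero)

lemma mfps_map_var: "mfps_map h (mfps_var i) = mfps_var i"
  by (auto simp: mfps_eq_iff mfps_nth_var zero one)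

lemma mfps_map_add: "mfps_map h (F + G) = mfps_map h F + mfps_map h G"
  by (simp add: mfps_eq_iff add)

end

text \<open>View \<theta>(r) as a series in U and apply \<theta> to its coefficients. This and
  \<theta>(r) at T + U are homomorphisms sending f_i to f_i + T_i + U_i, both with value \<theta>(r)
  at U = 0. Equality at T^\<alpha> U^\<beta> is iterativity.\<close>

theorem theta_iterative:
  assumes jac: "det (poly_jacobian f) dvd 1"
  shows "iterative_on UNIV (theta f)"
proof -
  note \<theta> = is_theta_homD[OF theta_hom_theta[OF jac]]
  interpret \<theta>: ring_hom_UNIV "theta f" by unfold_locales (rule \<theta>)
  interpret const: ring_hom_UNIV mfps_const by unfold_locales (rule ring_hom_mfps_const)
  interpret d: ring_hom_UNIV mfps_double by unfold_locales (rule ring_hom_mfps_double)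
  have "(\<lambda>r. mfps_map (theta f) (theta f r)) = (\<lambda>r. mfps_double (theta f r))"
  proof (rule hom_unique_of_jacobian[OF jac])
    show "ring_hom_on UNIV (\<lambda>r. mfps_map (theta f) (theta f r))"
      by (rule ring_hom_on_compose[OF \<theta>(1) ring_hom_mfps_map[OF \<theta>(1)]])
    show "ring_hom_on UNIV (\<lambda>r. mfps_double (theta f r))"
      by (rule ring_hom_on_compose[OF \<theta>(1) ring_hom_mfps_double])
    show "mfps_nth (mfps_map (theta f) (theta f r)) 0 = mfps_nth (mfps_double (theta f r)) 0" for r
      by (rule mfps_eqI) (simp add: \<theta>)
  qed (simp_all add: \<theta> \<theta>.mfps_map_const \<theta>.mfps_map_var \<theta>.mfps_map_add d.add const.add mfps_double_const
      mfps_double_var add.assoc)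
  then have eq: "mfps_map (theta f) (theta f r) = mfps_double (theta f r)" for r
    by (rule fun_cong)
  show ?thesis
    unfolding iterative_on_def hd_coeff_def
  proof (intro ballI allI)
    fix r \<alpha> \<beta>
    show "mfps_nth (theta f (mfps_nth (theta f r) \<beta>)) \<alpha> =
        of_nat (mbinom (\<alpha> + \<beta>) \<alpha>) * mfps_nth (theta f r) (\<alpha> + \<beta>)"
      using arg_cong[OF eq, of "\<lambda>F. mfps_nth (mfps_nth F \<beta>) \<alpha>" r] by simp
  qed
qed

text \<open>Iterativity at e_i and L e_i has the binomial factor L + 1; these factors accumulate to
  the factorial.\<close>

lemma iterative_fact:
  assumes jac: "det (poly_jacobian f) dvd 1"
  shows "of_nat (fact L) * theta_dir f i L g = (theta_dir f i 1 ^^ L) g"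
proof (induction L)
  note \<theta> = is_theta_homD[OF theta_hom_theta[OF jac]]
  interpret \<theta>: ring_hom_UNIV "theta f" by unfold_locales (rule \<theta>)
  {
    case 0
    show ?case by (simp add: theta_dir_def hd_coeff_def \<theta>)
  next
    case (Suc L)
    \<comment> \<open>Moves the factor L! of the induction hypothesis past the derivative.\<close>
    have D_of_nat: "theta_dir f i 1 (of_nat n * g) = of_nat n * theta_dir f i 1 g" for n g
      by (induction n) (simp_all add: theta_dir_def hd_coeff_def \<theta>.zero \<theta>.add algebra_simps)
    have "mbinom (Poly_Mapping.single i 1 + Poly_Mapping.single i L) (Poly_Mapping.single i 1) =
        (\<Prod>j\<in>UNIV. if j = i then Suc L else 1)"
      unfolding mbinom_def by (intro prod.cong) (auto simp: lookup_add lookup_single)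
    then have "theta_dir f i 1 (theta_dir f i L g) = of_nat (Suc L) * theta_dir f i (Suc L) g"
      using theta_iterative[OF jac]
      by (simp add: iterative_on_def theta_dir_def single_add[symmetric] del: of_nat_Suc)
    note step = this
    have "(theta_dir f i 1 ^^ Suc L) g = theta_dir f i 1 (of_nat (fact L) * theta_dir f i L g)"
      by (simp add: Suc.IH)
    also have "\<dots> = of_nat (fact L) * (of_nat (Suc L) * theta_dir f i (Suc L) g)"
      by (simp only: D_of_nat step)
    also have "\<dots> = of_nat (fact (Suc L)) * theta_dir f i (Suc L) g"
      by (simp add: algebra_simps)
    finally show ?case ..
  }
qed


section \<open>Base change\<close>

context ring_hom_UNIV
begin

text \<open>\<open>Poly_Mapping.map\<close> applies \<open>h\<close> to nonzero coefficients only;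
  \<open>h 0 = 0\<close> makes the formula uniform.\<close>

lemma lookup_map: "Poly_Mapping.lookup (Poly_Mapping.map h p) \<alpha> = h (Poly_Mapping.lookup p \<alpha>)"
  by (simp add: Poly_Mapping.map.rep_eq zero when_def)

lemma map_single: "Poly_Mapping.map h (Poly_Mapping.single \<alpha> c) = Poly_Mapping.single \<alpha> (h c)"
  by (rule poly_mapping_eqI) (simp add: lookup_map lookup_single when_def zero)

lemma map_add: "Poly_Mapping.map h (p + q) = Poly_Mapping.map h p + Poly_Mapping.map h q"
  by (rule poly_mapping_eqI) (simp add: lookup_map lookup_add add)

lemma map_mult:
  fixes p q :: "('n::finite, 'r) mvpoly"
  shows "Poly_Mapping.map h (p * q) = Poly_Mapping.map h p * Poly_Mapping.map h q"
proof (induction p rule: mvpoly_induct_single)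
  case (single \<alpha> c)
  show ?case
    by (induction q rule: mvpoly_induct_single)
      (simp_all add: mult_single map_single map_add mult distrib_left)
qed (simp add: map_add distrib_right)

lemma map_pconst: "Poly_Mapping.map h (pconst c) = pconst (h c)"
  by (simp add: pconst_def map_single)

lemma ring_hom_map:
  "ring_hom_on UNIV (Poly_Mapping.map h :: ('n::finite, 'r) mvpoly \<Rightarrow> ('n, 's) mvpoly)"
  using map_pconst[of 1] by (simp add: ring_hom_on_def map_add map_mult one pconst.one)

lemma map_pdiff: "Poly_Mapping.map h (pdiff j p) = pdiff j (Poly_Mapping.map h p)"
  by (induction p rule: mvpoly_induct_single)
    (simp_all add: pdiff_add map_add pdiff_single map_single mult of_nat)

lemma map_det_jacobian:
  fixes f :: "'n::finite \<Rightarrow> ('n, 'r) mvpoly"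
  shows "Poly_Mapping.map h (det (poly_jacobian f)) = det (poly_jacobian (\<lambda>i. Poly_Mapping.map h (f i)))"
proof -
  interpret m: ring_hom_UNIV "Poly_Mapping.map h :: ('n, 'r) mvpoly \<Rightarrow> ('n, 's) mvpoly"
    by unfold_locales (rule ring_hom_map)
  show ?thesis by (simp add: m.det poly_jacobian_def map_pdiff)
qed

end

text \<open>Both composites send f_i to \<Phi>(f_i) + T_i and r to a series with constant term
  \<Phi>(r). Uniqueness is applied to the tuple f over A, with values over A'.\<close>

theorem theta_base_change:
  fixes \<phi> :: "'a::comm_ring_1 \<Rightarrow> 'b::comm_ring_1" and f :: "'n::finite \<Rightarrow> ('n, 'a) mvpoly"
  assumes jac: "det (poly_jacobian f) dvd 1" and \<phi>: "ring_hom_on UNIV \<phi>"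
  shows "det (poly_jacobian (\<lambda>i. Poly_Mapping.map \<phi> (f i))) dvd 1"
    and "mfps_map (Poly_Mapping.map \<phi>) \<circ> theta f =
      theta (\<lambda>i. Poly_Mapping.map \<phi> (f i)) \<circ> Poly_Mapping.map \<phi>"
proof -
  interpret \<phi>: ring_hom_UNIV \<phi> by unfold_locales (rule \<phi>)
  interpret \<Phi>: ring_hom_UNIV "Poly_Mapping.map \<phi> :: ('n, 'a) mvpoly \<Rightarrow> ('n, 'b) mvpoly"
    by unfold_locales (rule \<phi>.ring_hom_map)
  show jac': "det (poly_jacobian (\<lambda>i. Poly_Mapping.map \<phi> (f i))) dvd 1"
    using \<Phi>.dvd_one[OF jac] by (simp add: \<phi>.map_det_jacobian)
  note \<theta> = is_theta_homD[OF theta_hom_theta[OF jac]]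
  note \<theta>' = is_theta_homD[OF theta_hom_theta[OF jac']]
  show "mfps_map (Poly_Mapping.map \<phi>) \<circ> theta f =
      theta (\<lambda>i. Poly_Mapping.map \<phi> (f i)) \<circ> Poly_Mapping.map \<phi>"
  proof (rule hom_unique_of_jacobian[OF jac])
    show "ring_hom_on UNIV (mfps_map (Poly_Mapping.map \<phi>) \<circ> theta f)"
      unfolding comp_def by (rule ring_hom_on_compose[OF \<theta>(1) ring_hom_mfps_map[OF \<phi>.ring_hom_map]])
    show "ring_hom_on UNIV (theta (\<lambda>i. Poly_Mapping.map \<phi> (f i)) \<circ> Poly_Mapping.map \<phi>)"
      unfolding comp_def by (rule ring_hom_on_compose[OF \<phi>.ring_hom_map \<theta>'(1)])
  qed (simp_all add: \<theta> \<theta>' \<phi>.map_pconst \<Phi>.mfps_map_const \<Phi>.mfps_map_var \<Phi>.mfps_map_add)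
qed


section \<open>Characteristic \<open>p\<^sup>e\<close>\<close>

text \<open>Since j times the binomial coefficient is divisible by p^N, the p-adic valuations of the
  two factors add up to at least N.\<close>

lemma prime_power_dvd_binomial:
  fixes p :: nat
  assumes "prime p" "0 < j" "multiplicity p j + e \<le> N"
  shows "p ^ e dvd (p ^ N choose j)"
proof (cases "p ^ N choose j = 0")
  case False
  have "p ^ N dvd j * (p ^ N choose j)"
    using times_binomial_minus1_eq[OF \<open>0 < j\<close>, of "p ^ N"] by simp
  moreover have "p ^ N > 0" and unit: "\<not> is_unit p"
    using \<open>prime p\<close> by (auto simp: prime_gt_0_nat)
  ultimately have "N \<le> multiplicity p (j * (p ^ N choose j))"
    using False assms(2) by (subst power_dvd_iff_le_multiplicity[symmetric]) auto
  also have "\<dots> = multiplicity p j + multiplicity p (p ^ N choose j)"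
    using False assms by (intro prime_elem_multiplicity_mult_distrib) auto
  finally show ?thesis using assms(3) by (intro multiplicity_dvd') simp
qed (simp only: dvd_0_right)

lemma of_nat_binomial_eq_0:
  assumes "prime p" "CHAR('a::comm_ring_1) = p ^ e" "0 < j" "multiplicity p j + e \<le> N"
  shows "of_nat (p ^ N choose j) = (0 :: 'a)"
  using prime_power_dvd_binomial[OF assms(1,3,4)] assms(2) by (simp add: of_nat_eq_0_iff_char_dvd)

section \<open>Restriction to one axis: T_k = 0 for k \<noteq> i\<close>

definition mfps_axis :: "'n::finite \<Rightarrow> ('n, 'r::comm_ring_1) mfps \<Rightarrow> 'r fps" where
  "mfps_axis i F = Abs_fps (\<lambda>k. mfps_nth F (Poly_Mapping.single i k))"

lemma fps_nth_axis [simp]: "fps_nth (mfps_axis i F) k = mfps_nth F (Poly_Mapping.single i k)"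
  by (simp add: mfps_axis_def)

lemma ring_hom_mfps_axis:
  "ring_hom_on UNIV (mfps_axis i :: ('n::finite, 'r::comm_ring_1) mfps \<Rightarrow> 'r fps)"
  unfolding ring_hom_on_def
proof (intro conjI ballI)
  show "mfps_axis i (1 :: ('n, 'r) mfps) = 1"
    by (auto simp: fps_eq_iff mfps_nth_one)
next
  fix F G :: "('n, 'r) mfps"
  show "mfps_axis i (F + G) = mfps_axis i F + mfps_axis i G"
    by (simp add: fps_eq_iff)
  have "(\<Sum>(\<beta>, \<gamma>)\<in>{(\<beta>, \<gamma>). \<beta> + \<gamma> = Poly_Mapping.single i n}. mfps_nth F \<beta> * mfps_nth G \<gamma>) =
      (\<Sum>k=0..n. mfps_nth F (Poly_Mapping.single i k) * mfps_nth G (Poly_Mapping.single i (n - k)))" for n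
  proof (rule sum.reindex_bij_witness[where
        i = "\<lambda>k. (Poly_Mapping.single i k, Poly_Mapping.single i (n - k))" and
        j = "\<lambda>(\<beta>, \<gamma>). Poly_Mapping.lookup \<beta> i"])
    fix a assume a: "a \<in> {(\<beta>, \<gamma>). \<beta> + \<gamma> = Poly_Mapping.single i n}"
    obtain \<beta> \<gamma> where [simp]: "a = (\<beta>, \<gamma>)" by force
    have eq: "\<beta> + \<gamma> = Poly_Mapping.single i n" "\<gamma> + \<beta> = Poly_Mapping.single i n"
      using a by (auto simp: add.commute)
    have "Poly_Mapping.lookup \<beta> i + Poly_Mapping.lookup \<gamma> i = n"
      using eq by (metis lookup_add lookup_single_eq)
    then have n: "Poly_Mapping.lookup \<beta> i \<le> n" "n - Poly_Mapping.lookup \<beta> i = Poly_Mapping.lookup \<gamma> i"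
      by auto
    show "(case a of (\<beta>, \<gamma>) \<Rightarrow> Poly_Mapping.lookup \<beta> i) \<in> {0..n}"
      using n by simp
    show "(Poly_Mapping.single i (case a of (\<beta>, \<gamma>) \<Rightarrow> Poly_Mapping.lookup \<beta> i),
        Poly_Mapping.single i (n - (case a of (\<beta>, \<gamma>) \<Rightarrow> Poly_Mapping.lookup \<beta> i))) = a"
      using mindex_add_eq_single[OF eq(1)] mindex_add_eq_single[OF eq(2)] n by simp
    then show "mfps_nth F (Poly_Mapping.single i (case a of (\<beta>, \<gamma>) \<Rightarrow> Poly_Mapping.lookup \<beta> i)) *
        mfps_nth G (Poly_Mapping.single i (n - (case a of (\<beta>, \<gamma>) \<Rightarrow> Poly_Mapping.lookup \<beta> i))) =
        (case a of (\<beta>, \<gamma>) \<Rightarrow> mfps_nth F \<beta> * mfps_nth G \<gamma>)"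
      by simp
  qed (auto simp: single_add[symmetric])
  then show "mfps_axis i (F * G) = mfps_axis i F * mfps_axis i G"
    by (simp add: fps_eq_iff fps_mult_nth mfps_nth_mult)
qed

lemma fps_nth_linear_power:
  "fps_nth ((fps_const c + fps_X) ^ n) L = of_nat (n choose L) * (c :: 'r::comm_ring_1) ^ (n - L)"
proof -
  have "(fps_const c + fps_X) ^ n = (\<Sum>k\<le>n. fps_X ^ k * fps_const (of_nat (n choose k) * c ^ (n - k)))"
    unfolding add.commute[of "fps_const c"] binomial_ring
    by (intro sum.cong refl)
      (simp add: fps_const_power fps_of_nat[symmetric] fps_const_mult[symmetric] mult_ac del: fps_const_mult)
  then show ?thesis
    by (simp add: fps_sum_nth if_distrib[of "\<lambda>x. x * _"] not_le binomial_eq_0 cong: if_cong)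
qed

text \<open>Write F = c + T u and expand. The term j = 0 is constant, the terms with 1 \<le> j \<le>
  k vanish by hypothesis, and those with j > k start too late.\<close>

lemma fps_nth_power_eq_0:
  fixes F :: "'r::comm_ring_1 fps"
  assumes "\<And>j. 0 < j \<Longrightarrow> j \<le> L \<Longrightarrow> of_nat (q choose j) = (0 :: 'r)" and k: "0 < k" "k \<le> L"
  shows "fps_nth (F ^ q) k = 0"
proof -
  define u where "u = fps_shift 1 F"
  have "F = fps_X * u + fps_const (fps_nth F 0)"
    by (auto simp: fps_eq_iff u_def)
  then have "F ^ q = (fps_X * u + fps_const (fps_nth F 0)) ^ q" by simp
  also have "\<dots> = (\<Sum>j\<le>q. fps_X ^ j * (fps_const (of_nat (q choose j)) * u ^ j * fps_const (fps_nth F 0 ^ (q - j))))"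
    unfolding binomial_ring by (intro sum.cong refl)
      (simp add: fps_const_power fps_of_nat power_mult_distrib mult_ac)
  finally have "fps_nth (F ^ q) k = (\<Sum>j\<le>q. fps_nth (fps_X ^ j *
      (fps_const (of_nat (q choose j)) * u ^ j * fps_const (fps_nth F 0 ^ (q - j)))) k)"
    by (simp add: fps_sum_nth)
  also have "\<dots> = 0"
  proof (rule sum.neutral, rule ballI)
    fix j
    show "fps_nth (fps_X ^ j *
        (fps_const (of_nat (q choose j)) * u ^ j * fps_const (fps_nth F 0 ^ (q - j)))) k = 0"
    proof (cases "0 < j \<and> j \<le> k")
      case True
      then show ?thesis using assms by simp
    next
      case False
      then show ?thesis using k by (auto simp: fps_X_power_mult_nth)
    qed
  qed
  finally show ?thesis .
qed

lemma mpow_split: "mpow f \<alpha> = f i ^ Poly_Mapping.lookup \<alpha> i * (\<Prod>j\<in>-{i}. f j ^ Poly_Mapping.lookup \<alpha> j)"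
  unfolding mpow_def by (subst prod.remove[of _ i]) (auto simp: Compl_eq_Diff_UNIV)

lemma fps_const_prod: "fps_const (prod g A) = (\<Prod>x\<in>A. fps_const (g x :: 'r::comm_ring_1))"
proof (induction A rule: infinite_finite_induct)
  case (insert x A)
  then show ?case by (simp add: fps_const_mult[symmetric] del: fps_const_mult)
qed simp_all

text \<open>H is \<theta> with all variables but T_i set to zero. Modulo T^(L+1) it fixes
  polynomials in the x_k^q, hence is linear over them, and it sends f_i to f_i + T and fixes the
  other f_j. A general q serves both choices of N.\<close>

lemma theta_dir_box_sum:
  fixes f :: "'n::finite \<Rightarrow> ('n, 'a::comm_ring_1) mvpoly"
  assumes jac: "det (poly_jacobian f) dvd 1"
    and q: "\<And>j. 0 < j \<Longrightarrow> j \<le> L \<Longrightarrow> of_nat (q choose j) = (0 :: 'a)"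
  shows "theta_dir f i L (box_sum q a (mpow f)) =
    box_sum q a (\<lambda>\<alpha>. of_nat (Poly_Mapping.lookup \<alpha> i choose L) *
      mpow f (\<alpha> - Poly_Mapping.single i L))"
proof -
  note \<theta> = is_theta_homD[OF theta_hom_theta[OF jac]]
  define H where "H r = mfps_axis i (theta f r)" for r
  interpret H: ring_hom_UNIV H
    unfolding H_def by unfold_locales (rule ring_hom_on_compose[OF \<theta>(1) ring_hom_mfps_axis])
  have dir: "theta_dir f i L r = fps_nth (H r) L" for r
    by (simp add: H_def theta_dir_def hd_coeff_def)
  have H0: "fps_nth (H r) 0 = r" for r
    by (simp add: H_def \<theta>)
  \<comment> \<open>The p with this property are closed under products: in positive degree every
    convolution term has a factor of positive degree at most L.\<close>
  have const: "fps_nth (H (psubst (\<lambda>k. pvar k ^ q) p)) k = 0" if "0 < k" "k \<le> L" for p k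
    using that
  proof (induction p arbitrary: k rule: mvpoly_induct)
    case (pconst c)
    then show ?case
      by (simp add: H_def \<theta> mfps_nth_const)
  next
    case (pvar j)
    have "of_nat (q choose l) = (0 :: ('n, 'a) mvpoly)" if "0 < l" "l \<le> L" for l
      using arg_cong[OF q[OF that], of "pconst :: _ \<Rightarrow> ('n, 'a) mvpoly"]
      by (simp add: pconst.of_nat pconst.zero)
    from fps_nth_power_eq_0[OF this pvar] show ?case by (simp add: H.power)
  next
    case (mult p p')
    let ?Q = "psubst (\<lambda>k. pvar k ^ q)"
    have "fps_nth (H (?Q p)) l * fps_nth (H (?Q p')) (k - l) = 0" if "l \<in> {0..k}" for l
    proof (cases "l = 0")
      case True
      then show ?thesis using mult.IH(2)[OF mult.prems] by simp
    next
      case False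
      then show ?thesis using mult.IH(1)[of l] mult.prems that by simp
    qed
    then show ?case
      by (simp add: psubst.mult H.mult fps_mult_nth)
  qed (simp add: psubst.add H.add)
  have Hf: "H (f j) = fps_const (f j) + (if j = i then fps_X else 0)" for j
  proof (rule fps_ext)
    fix k
    have "Poly_Mapping.single i k = Poly_Mapping.single j (1::nat) \<longleftrightarrow> i = j \<and> k = 1"
      by (metis lookup_single_eq lookup_single_not_eq one_neq_zero)
    then show "fps_nth (H (f j)) k = fps_nth (fps_const (f j) + (if j = i then fps_X else 0)) k"
      by (auto simp: H_def \<theta> mfps_nth_const mfps_nth_var)
  qed
  have Hmpow: "fps_nth (H (mpow f \<alpha>)) L =
      of_nat (Poly_Mapping.lookup \<alpha> i choose L) * mpow f (\<alpha> - Poly_Mapping.single i L)" for \<alpha>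
  proof -
    have "H (mpow f \<alpha>) = (fps_const (f i) + fps_X) ^ Poly_Mapping.lookup \<alpha> i *
        (\<Prod>j\<in>-{i}. fps_const (f j) ^ Poly_Mapping.lookup \<alpha> j)"
      by (simp add: mpow_split[of _ _ i] H.mult H.power H.prod Hf)
    also have "(\<Prod>j\<in>-{i}. fps_const (f j) ^ Poly_Mapping.lookup \<alpha> j) =
        fps_const (\<Prod>j\<in>-{i}. f j ^ Poly_Mapping.lookup \<alpha> j)"
      by (simp add: fps_const_power fps_const_prod)
    finally have "fps_nth (H (mpow f \<alpha>)) L = of_nat (Poly_Mapping.lookup \<alpha> i choose L) *
        f i ^ (Poly_Mapping.lookup \<alpha> i - L) * (\<Prod>j\<in>-{i}. f j ^ Poly_Mapping.lookup \<alpha> j)"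
      by (simp add: fps_nth_linear_power)
    \<comment> \<open>For L > \<alpha>_i both exponents truncate to zero alike, and the binomial
      coefficient vanishes.\<close>
    moreover have "mpow f (\<alpha> - Poly_Mapping.single i L) =
        f i ^ (Poly_Mapping.lookup \<alpha> i - L) * (\<Prod>j\<in>-{i}. f j ^ Poly_Mapping.lookup \<alpha> j)"
      unfolding mpow_split[of _ _ i]
      by (auto simp: lookup_minus lookup_single when_def intro!: arg_cong2[of _ _ _ _ "(*)"] prod.cong)
    ultimately show ?thesis by (simp add: mult.assoc)
  qed
  have "fps_nth (H (psubst (\<lambda>k. pvar k ^ q) (a \<alpha>) * mpow f \<alpha>)) L = psubst (\<lambda>k. pvar k ^ q) (a \<alpha>) *
      fps_nth (H (mpow f \<alpha>)) L" for \<alpha>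
  proof -
    have "fps_nth (H (psubst (\<lambda>k. pvar k ^ q) (a \<alpha>) * mpow f \<alpha>)) L =
        (\<Sum>k\<in>{0..L}. fps_nth (H (psubst (\<lambda>k. pvar k ^ q) (a \<alpha>))) k * fps_nth (H (mpow f \<alpha>)) (L - k))"
      by (simp add: H.mult fps_mult_nth)
    \<comment> \<open>By \<open>const\<close> only the constant term of the first factor
      contributes.\<close>
    also have "\<dots> = (\<Sum>k\<in>{0}. fps_nth (H (psubst (\<lambda>k. pvar k ^ q) (a \<alpha>))) k * fps_nth (H (mpow f \<alpha>)) (L - k))"
      by (rule sum.mono_neutral_right) (auto simp: const)
    finally show ?thesis by (simp add: H0)
  qed
  then show ?thesis
    by (simp add: dir box_sum_def H.sum fps_sum_nth Hmpow)
qed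

text \<open>The bound in (i) uses an integer power of a real number because N - e + 1 may be
  negative; truncated subtraction would weaken the hypothesis for N < e. The class
  \<open>comm_ring_1\<close> makes both rings nonzero.\<close>

theorem proposition4p8:
  fixes f :: "'n::finite \<Rightarrow> ('n, 'a::comm_ring_1) mvpoly"
    and \<phi> :: "'a \<Rightarrow> 'b::comm_ring_1"
  assumes jac: "det (poly_jacobian f) dvd 1"
  shows
    "(\<exists>!\<theta>\<^sub>0. is_theta_subalg f \<theta>\<^sub>0) \<and>
     higher_derivation_on (subalg f) (theta_subalg f) \<and>
     iterative_on (subalg f) (theta_subalg f) \<and>
     (\<exists>!\<theta>. is_theta_extension f \<theta>) \<and>
     \<comment> \<open>(i)\<close>
     (\<forall>p e. prime (p::nat) \<and> CHAR('a) = p ^ e \<longrightarrow>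
        (\<forall>L i N a. real p powi (int N - int e + 1) > real L \<longrightarrow>
           theta_dir f i L (box_sum (p ^ N) a (mpow f)) =
           box_sum (p ^ N) a (\<lambda>\<alpha>. of_nat (Poly_Mapping.lookup \<alpha> i choose L) *
             mpow f (\<alpha> - Poly_Mapping.single i L))) \<and>
        (\<forall>L i N a. N = e + multiplicity p (fact L) \<longrightarrow>
           theta_dir f i L (box_sum (p ^ N) a (mpow f)) =
           box_sum (p ^ N) a (\<lambda>\<alpha>. of_nat (Poly_Mapping.lookup \<alpha> i choose L) *
             mpow f (\<alpha> - Poly_Mapping.single i L)))) \<and>
     \<comment> \<open>(ii)\<close>
     iterative_on UNIV (theta f) \<and>
     (\<forall>L i g. L > 0 \<longrightarrow> of_nat (fact L) * theta_dir f i L g = (theta_dir f i 1 ^^ L) g) \<and>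
     \<comment> \<open>(iii)\<close>
     (ring_hom_on UNIV \<phi> \<longrightarrow>
        (let \<Phi> = Poly_Mapping.map \<phi> in
           det (poly_jacobian (\<lambda>i. \<Phi> (f i))) dvd 1 \<and>
           mfps_map \<Phi> \<circ> theta f = theta (\<lambda>i. \<Phi> (f i)) \<circ> \<Phi>))"
proof (intro conjI allI impI)
  note hom = theta_hom_theta[OF jac]
  note \<theta> = is_theta_homD[OF hom]
  have sub: "theta_subalg f g = theta f g" if "g \<in> subalg f" for g
    using that by (simp add: theta_subalg_eq[OF hom])
  show "\<exists>!\<theta>\<^sub>0. is_theta_subalg f \<theta>\<^sub>0"
    using theta_hom_is_theta_subalg[OF hom] is_theta_subalg_unique by blast
  show "higher_derivation_on (subalg f) (theta_subalg f)"
    using \<theta> theta_hom_subalg[OF hom]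
    by (auto simp: higher_derivation_on_def ring_hom_on_def mfps_over_def sub subalg_add subalg_mult)
  \<comment> \<open>The coefficients stay in A[f], where \<open>theta_subalg\<close> agrees with
    \<open>theta\<close>, so the outer application can be rewritten too.\<close>
  show "iterative_on (subalg f) (theta_subalg f)"
    using theta_iterative[OF jac]
    by (simp add: iterative_on_def hd_coeff_def sub theta_hom_subalg[OF hom])
  show "\<exists>!\<theta>. is_theta_extension f \<theta>" by (rule ex1_theta_extension[OF jac])
  show "iterative_on UNIV (theta f)" by (rule theta_iterative[OF jac])
  show "of_nat (fact L) * theta_dir f i L g = (theta_dir f i 1 ^^ L) g" for L i g
    by (rule iterative_fact[OF jac])
  show "let \<Phi> = Poly_Mapping.map \<phi> in
      det (poly_jacobian (\<lambda>i. \<Phi> (f i))) dvd 1 \<and>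
      mfps_map \<Phi> \<circ> theta f = theta (\<lambda>i. \<Phi> (f i)) \<circ> \<Phi>" if "ring_hom_on UNIV \<phi>"
    using theta_base_change[OF jac that] by (simp add: Let_def)
next
  fix p e L i N and a :: "'n mindex \<Rightarrow> ('n, 'a) mvpoly"
  assume p: "prime (p::nat) \<and> CHAR('a) = p ^ e" and L: "real p powi (int N - int e + 1) > real L"
  have p1: "p > 1" using p prime_gt_1_nat by blast
  \<comment> \<open>With v the p-adic valuation, p^v(j) \<le> j \<le> L < p^(N-e+1) gives v(j) \<le>
    N - e.\<close>
  have "multiplicity p j + e \<le> N" if j: "0 < j" "j \<le> L" for j
  proof (cases "e \<le> N")
    case True
    have "p ^ multiplicity p j \<le> j" using j by (intro dvd_imp_le multiplicity_dvd) auto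
    moreover have "real L < real (p ^ (N - e + 1))"
      using L True by (simp add: power_int_def nat_add_distrib nat_diff_distrib of_nat_diff)
    ultimately have "p ^ multiplicity p j < p ^ (N - e + 1)" using j by linarith
    then show ?thesis using p1 True by (simp add: power_strict_increasing_iff del: power_Suc)
  next
    case False
    \<comment> \<open>For N < e the exponent is at most 0, so the hypothesis forces L = 0 and there
      is no such j.\<close>
    then have "real p powi (int N - int e + 1) \<le> 1"
      using power_int_increasing[of "int N - int e + 1" 0 "real p"] p1 by simp
    then show ?thesis using L j by simp
  qed
  then show "theta_dir f i L (box_sum (p ^ N) a (mpow f)) =
      box_sum (p ^ N) a (\<lambda>\<alpha>. of_nat (Poly_Mapping.lookup \<alpha> i choose L) *
        mpow f (\<alpha> - Poly_Mapping.single i L))"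
    using p by (intro theta_dir_box_sum[OF jac] of_nat_binomial_eq_0[of p e]) auto
next
  fix p e L i N and a :: "'n mindex \<Rightarrow> ('n, 'a) mvpoly"
  assume p: "prime (p::nat) \<and> CHAR('a) = p ^ e" and N: "N = e + multiplicity p (fact L)"
  \<comment> \<open>Every such j divides L!, so its valuation is at most that of L!.\<close>
  have "multiplicity p j + e \<le> N" if j: "0 < j" "j \<le> L" for j
    using dvd_imp_multiplicity_le[of j "fact L" p] dvd_fact[of j L] j N by simp
  then show "theta_dir f i L (box_sum (p ^ N) a (mpow f)) =
      box_sum (p ^ N) a (\<lambda>\<alpha>. of_nat (Poly_Mapping.lookup \<alpha> i choose L) *
        mpow f (\<alpha> - Poly_Mapping.single i L))"
    using p by (intro theta_dir_box_sum[OF jac] of_nat_binomial_eq_0[of p e]) auto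
qed

end
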